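(* A finite connected graph $\Gamma$ (without loops or multiple edges) is the line graph of a multi-graph if and only if $\overline\Gamma$, regarded as the graph induced on the images of the vertices in the minimal orthogonal embedding of $\Gamma$, is equivalent to a graph isomorphic to $A_n$ for some integer $n$.
   Context: A multi-graph has no loops but may have multiple edges; its line graph has its edges as vertices, two edges adjacent iff they meet in exactly one vertex. Orthogonal $\mathbb F_2$-space $(V,Q)$: $\mathbb F_2$-vector space with quadratic form $Q$, bilinear form $f(u,w)=Q(u+w)+Q(u)+Q(w)$; $v$ anisotropic if $Q(v)=1$; isotropic radical $\{v: Q(v)=0, f(v,w)=0\ \forall w\}$. The graph induced on a set $\mathcal W$ of anisotropic vectors has vertex set $\mathcal W$, distinct $x,y$ adjacent iff $Q(x+y)=1$. The elementary transformation $(v,w)$, $v,w\in\mathcal W$, replaces $\mathcal W$ by $(\mathcal W\setminus\{w\})\cup\{w+f(v,w)v\}$; two such induced graphs are equivalent if one arises from the other by finitely many elementary transformations. Universal embedding of $\Gamma$ with vertex set $\mathcal V$: $V_\Gamma$ = finite subsets of $\mathcal V$ under symmetric difference, $v\equiv\{v\}$; with a total order on $\mathcal V$, $Q_\Gamma(u)$ is the number mod 2 of pairs $(x,y)\in u\times u$ with $x=y$ or ($x<y$ and $\{x,y\}$ an edge). Minimal embedding: the quotient $V_\Gamma/R_0$ by the isotropic radical $R_0$ of $(V_\Gamma,Q_\Gamma)$ with the induced quadratic form; $\overline\Gamma$ is the graph induced on $\{\{v\}+R_0: v\in\mathcal V\}$. $A_n$ denotes the path on $n$ vertices. *)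

theory Defs
  imports
    "Graph_Theory.Graph_Theory"
    "HOL-Algebra.Coset"
    "HOL-Library.Z2"
begin

section \<open>Multi-graphs and line graphs\<close>

text \<open>
  Simple graphs are rendered as symmetric loop-free \<open>pair_pre_digraph\<close>s (locale \<open>pair_graph\<close> in
  the finite case): each edge is present as two opposite arcs.
\<close>

record ('v, 'e) multigraph =
  mverts :: "'v set"
  medges :: "'e set"
  ends :: "'e \<Rightarrow> 'v set"

definition multigraph :: "('v, 'e) multigraph \<Rightarrow> bool" where
  "multigraph M \<longleftrightarrow> (\<forall>e\<in>medges M. ends M e \<subseteq> mverts M \<and> card (ends M e) = 2)"

definition line_graph :: "('v, 'e) multigraph \<Rightarrow> 'e pair_pre_digraph" where
  "line_graph M = \<lparr> pverts = medges M,
     parcs = {(e, e'). e \<in> medges M \<and> e' \<in> medges M \<and> card (ends M e \<inter> ends M e') = 1} \<rparr>"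

text \<open>
  HOL cannot quantify existentially over the vertex and edge types of the multi-graph. For a finite
  graph the types chosen here are no restriction, see \<open>is_line_graphI\<close>.
\<close>

definition is_line_graph :: "'a pair_pre_digraph \<Rightarrow> bool" where
  "is_line_graph G \<longleftrightarrow> (\<exists>M :: (nat, 'a) multigraph.
     multigraph M \<and> digraph_iso (with_proj (line_graph M)) (with_proj G))"

definition path_graph :: "nat \<Rightarrow> nat pair_pre_digraph" where
  "path_graph n = \<lparr> pverts = {..<n},
     parcs = {(i, j). i < n \<and> j < n \<and> (j = Suc i \<or> i = Suc j)} \<rparr>"

section \<open>Orthogonal spaces over the field with two elements\<close>

text \<open>
  An \<open>\<bbbF>\<^sub>2\<close>-vector space is an abelian group in which every element has order at most two. Vector
  addition is the group operation \<open>\<otimes>\<close>, the zero vector is \<open>\<one>\<close>, and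
  \<open>\<bbbF>\<^sub>2\<close> is the type \<open>bit\<close>.
\<close>

record 'v quad_space = "'v monoid" +
  qf :: "'v \<Rightarrow> bit"

definition bil :: "'v quad_space \<Rightarrow> 'v \<Rightarrow> 'v \<Rightarrow> bit" where
  "bil V u w = qf V (u \<otimes>\<^bsub>V\<^esub> w) + qf V u + qf V w"

definition scal :: "'v quad_space \<Rightarrow> bit \<Rightarrow> 'v \<Rightarrow> 'v" where
  "scal V a v = (if a = 1 then v else \<one>\<^bsub>V\<^esub>)"

text \<open>Homogeneity of the quadratic form only says that \<open>Q(0) = 0\<close>.\<close>

locale orthogonal_space = comm_group V for V :: "'v quad_space" (structure) +
  assumes exponent_two: "v \<in> carrier V \<Longrightarrow> v \<otimes> v = \<one>"
    and qf_zero: "qf V \<one> = 0"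
    and bil_add_left: "\<lbrakk>u \<in> carrier V; v \<in> carrier V; w \<in> carrier V\<rbrakk>
          \<Longrightarrow> bil V (u \<otimes> v) w = bil V u w + bil V v w"
    and bil_add_right: "\<lbrakk>u \<in> carrier V; v \<in> carrier V; w \<in> carrier V\<rbrakk>
          \<Longrightarrow> bil V u (v \<otimes> w) = bil V u v + bil V u w"

definition isotropic_radical :: "'v quad_space \<Rightarrow> 'v set" where
  "isotropic_radical V =
     {v \<in> carrier V. qf V v = 0 \<and> (\<forall>w\<in>carrier V. bil V v w = 0)}"

definition anisotropic :: "'v quad_space \<Rightarrow> 'v set" where
  "anisotropic V = {v \<in> carrier V. qf V v = 1}"

definition induced_graph :: "'v quad_space \<Rightarrow> 'v set \<Rightarrow> 'v pair_pre_digraph" where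
  "induced_graph V W = \<lparr> pverts = W,
     parcs = {(x, y). x \<in> W \<and> y \<in> W \<and> x \<noteq> y \<and> qf V (x \<otimes>\<^bsub>V\<^esub> y) = 1} \<rparr>"

definition elementary_transformation :: "'v quad_space \<Rightarrow> 'v set \<Rightarrow> 'v set \<Rightarrow> bool" where
  "elementary_transformation V W W' \<longleftrightarrow>
     (\<exists>v\<in>W. \<exists>w\<in>W. W' = (W - {w}) \<union> {w \<otimes>\<^bsub>V\<^esub> scal V (bil V v w) v})"

text \<open>
  The graphs induced on \<open>W\<close> and \<open>W'\<close> are equivalent. Since the vectors form a set, a transformation
  may merge two of them, so transformability is not symmetric; both directions are admitted.
\<close>

definition equivalent_sets :: "'v quad_space \<Rightarrow> 'v set \<Rightarrow> 'v set \<Rightarrow> bool" where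
  "equivalent_sets V W W' \<longleftrightarrow> W \<subseteq> anisotropic V \<and> W' \<subseteq> anisotropic V \<and>
     ((elementary_transformation V)\<^sup>*\<^sup>* W W' \<or> (elementary_transformation V)\<^sup>*\<^sup>* W' W)"

section \<open>Universal and minimal embedding\<close>

text \<open>\<open>r\<close> is a reflexive total order on the vertices, as in \<open>linear_order_on\<close>.\<close>

definition universal_embedding :: "'a pair_pre_digraph \<Rightarrow> 'a rel \<Rightarrow> 'a set quad_space" where
  "universal_embedding G r =
     \<lparr> carrier = {u. finite u \<and> u \<subseteq> pverts G},
       monoid.mult = (\<lambda>u w. (u - w) \<union> (w - u)),
       one = {},
       qf = (\<lambda>u. of_nat (card {(x, y) \<in> u \<times> u.
                   x = y \<or> ((x, y) \<in> r \<and> x \<noteq> y \<and> (x, y) \<in> parcs G)})) \<rparr>"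

definition radical_quotient :: "'v quad_space \<Rightarrow> 'v set quad_space" where
  "radical_quotient V = (let X = V Mod isotropic_radical V in
     \<lparr> carrier = carrier X, monoid.mult = monoid.mult X, one = one X,
       qf = (\<lambda>C. the_elem (qf V ` C)) \<rparr>)"

definition minimal_embedding :: "'a pair_pre_digraph \<Rightarrow> 'a rel \<Rightarrow> 'a set set quad_space" where
  "minimal_embedding G r = radical_quotient (universal_embedding G r)"

definition minimal_image :: "'a pair_pre_digraph \<Rightarrow> 'a rel \<Rightarrow> 'a set set set" where
  "minimal_image G r = (let V = universal_embedding G r in
     (\<lambda>v. isotropic_radical V #>\<^bsub>V\<^esub> {v}) ` pverts G)"

section \<open>Well-definedness\<close>

lemma digraph_iso_with_projI:
  assumes wf: "parcs G \<subseteq> pverts G \<times> pverts G"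
    and bij: "bij_betw h (pverts G) (pverts H)"
    and arcs: "parcs H = map_prod h h ` parcs G"
  shows "digraph_iso (with_proj G) (with_proj H)"
proof -
  let ?f = "\<lparr> iso_verts = h, iso_arcs = map_prod h h, iso_head = snd, iso_tail = fst \<rparr>"
  have "inj_on (map_prod h h) (parcs G)"
    using map_prod_inj_on[of h "pverts G" h "pverts G"] wf bij
    by (auto simp: bij_betw_def intro: inj_on_subset)
  moreover have "wf_digraph (with_proj G)"
    using wf by unfold_locales auto
  ultimately have "pre_digraph.digraph_isomorphism (with_proj G) ?f"
    using bij by (auto simp: pre_digraph.digraph_isomorphism_def bij_betw_def)
  moreover have "with_proj H = app_iso ?f (with_proj G)"
    using bij arcs by (auto simp: app_iso_def with_proj_def bij_betw_def)
  ultimately show ?thesis unfolding digraph_iso_def by blast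
qed

lemma digraph_iso_with_projE:
  assumes "digraph_iso (with_proj G) (with_proj H)"
  obtains h where "parcs G \<subseteq> pverts G \<times> pverts G"
    "bij_betw h (pverts G) (pverts H)" "parcs H = map_prod h h ` parcs G"
proof -
  obtain f where f: "pre_digraph.digraph_isomorphism (with_proj G) f"
    and H: "with_proj H = app_iso f (with_proj G)"
    using assms unfolding digraph_iso_def by blast
  have wf: "wf_digraph (with_proj G)"
    using f by (simp add: pre_digraph.digraph_isomorphism_def)
  have 1: "parcs G \<subseteq> pverts G \<times> pverts G"
    using wf_digraph.tail_in_verts[OF wf] wf_digraph.head_in_verts[OF wf] by fastforce
  have tl: "iso_tail f = fst" "iso_head f = snd"
    and vs: "pverts H = iso_verts f ` pverts G" and ar: "parcs H = iso_arcs f ` parcs G"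
    using H by (auto simp: app_iso_def with_proj_def)
  have 2: "bij_betw (iso_verts f) (pverts G) (pverts H)"
    using f vs by (simp add: bij_betw_def pre_digraph.digraph_isomorphism_def)
  have "iso_arcs f a = map_prod (iso_verts f) (iso_verts f) a" if "a \<in> parcs G" for a
    using f that by (auto simp: pre_digraph.digraph_isomorphism_def tl map_prod_def
        split: prod.splits intro!: prod_eqI)
  then have "parcs H = map_prod (iso_verts f) (iso_verts f) ` parcs G"
    unfolding ar by (intro image_cong) auto
  with 1 2 show thesis by (rule that)
qed

lemma is_line_graphI:
  fixes M :: "('v, 'e) multigraph" and G :: "'a pair_pre_digraph"
  assumes M: "multigraph M" and fin: "finite (pverts G)"
    and iso: "digraph_iso (with_proj (line_graph M)) (with_proj G)"
  shows "is_line_graph G"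
proof -
  obtain h where h: "bij_betw h (medges M) (pverts G)"
    and pG: "parcs G = map_prod h h ` parcs (line_graph M)"
    using digraph_iso_with_projE[OF iso] unfolding line_graph_def pair_pre_digraph.simps .
  define U where "U = (\<Union>e\<in>medges M. ends M e)"
  have fe: "finite (ends M e)" if "e \<in> medges M" for e
    using M that by (intro card_ge_0_finite) (auto simp: multigraph_def)
  have "finite (medges M)" using bij_betw_finite[OF h] fin by simp
  then have "finite U" using fe by (auto simp: U_def)
  then obtain g :: "'v \<Rightarrow> nat" where g: "inj_on g U"
    using finite_imp_inj_to_nat_seg[of U] by auto
  define k where "k = the_inv_into (medges M) h"
  have k: "k a \<in> medges M" "h (k a) = a" if "a \<in> pverts G" for a
    using h that unfolding k_def
    by (auto simp: bij_betw_def f_the_inv_into_f intro!: the_inv_into_into)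
  have kh: "k (h e) = e" if "e \<in> medges M" for e
    using h that by (simp add: k_def bij_betw_def the_inv_into_f_f)
  have he: "h e \<in> pverts G" if "e \<in> medges M" for e
    using h that by (auto simp: bij_betw_def)
  define N :: "(nat, 'a) multigraph" where
    "N = \<lparr> mverts = g ` U, medges = pverts G, ends = (\<lambda>a. g ` ends M (k a)) \<rparr>"
  have sub: "ends M e \<subseteq> U" if "e \<in> medges M" for e using that by (auto simp: U_def)
  have "multigraph N"
    unfolding multigraph_def
  proof
    fix a assume "a \<in> medges N"
    then have "k a \<in> medges M" using k(1) by (simp add: N_def)
    then have "ends M (k a) \<subseteq> U" "card (ends M (k a)) = 2"
      using M sub by (auto simp: multigraph_def)
    then show "ends N a \<subseteq> mverts N \<and> card (ends N a) = 2"
      using card_image[OF inj_on_subset[OF g]] by (auto simp: N_def)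
  qed
  moreover have "parcs (line_graph N) = parcs G"
  proof -
    have c: "card (g ` ends M e \<inter> g ` ends M e') = card (ends M e \<inter> ends M e')"
      if "e \<in> medges M" "e' \<in> medges M" for e e'
    proof -
      have "g ` ends M e \<inter> g ` ends M e' = g ` (ends M e \<inter> ends M e')"
        using inj_on_image_Int[OF g sub sub] that by simp
      moreover have "inj_on g (ends M e \<inter> ends M e')"
        using g sub[OF that(1)] by (meson Int_lower1 inj_on_subset order_trans)
      ultimately show ?thesis by (simp add: card_image)
    qed
    have "(a, a') \<in> parcs (line_graph N) \<longleftrightarrow> (a, a') \<in> parcs G" for a a'
    proof
      assume "(a, a') \<in> parcs (line_graph N)"
      then have a: "a \<in> pverts G" "a' \<in> pverts G"
        and "card (g ` ends M (k a) \<inter> g ` ends M (k a')) = 1"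
        by (auto simp: line_graph_def N_def)
      then have "(k a, k a') \<in> parcs (line_graph M)"
        using k(1) c by (simp add: line_graph_def)
      then have "map_prod h h (k a, k a') \<in> parcs G" unfolding pG by (rule imageI)
      then show "(a, a') \<in> parcs G" using a k(2) by simp
    next
      assume "(a, a') \<in> parcs G"
      then obtain e e' where "(e, e') \<in> parcs (line_graph M)" "a = h e" "a' = h e'"
        unfolding pG by auto
      then show "(a, a') \<in> parcs (line_graph N)"
        using kh he c by (simp add: line_graph_def N_def)
    qed
    then show ?thesis by auto
  qed
  then have "line_graph N = G"
    by (intro pair_pre_digraph.equality) (auto simp: line_graph_def N_def)
  moreover have "digraph_iso (with_proj (line_graph N)) (with_proj (line_graph N))"
    by (rule digraph_iso_with_projI[where h = id])
      (auto simp: line_graph_def bij_betw_def prod.map_id0)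
  ultimately show ?thesis unfolding is_line_graph_def by auto
qed

declare add_bit_eq_xor [simp del] mult_bit_eq_and [simp del]

lemma bit_add_self [simp]: "a + a = 0" "a + (a + b) = b" for a b :: bit
  by (cases a; cases b; simp)+

lemma sum_symdiff_bit:
  fixes g :: "'a \<Rightarrow> bit"
  assumes "finite u" "finite w"
  shows "sum g ((u - w) \<union> (w - u)) = sum g u + sum g w"
proof -
  have "sum g ((u - w) \<union> (w - u)) = sum g (u - w) + sum g (w - u)"
    using assms by (intro sum.union_disjoint) auto
  moreover have "sum g u = sum g (u - w) + sum g (u \<inter> w)"
    using assms by (metis add.commute sum.Int_Diff)
  moreover have "sum g w = sum g (w - u) + sum g (u \<inter> w)"
    using assms by (metis Int_commute add.commute sum.Int_Diff)
  ultimately show ?thesis by (simp add: ac_simps)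
qed

theorem orthogonal_space_universal_embedding: "orthogonal_space (universal_embedding G r)"
proof -
  let ?V = "universal_embedding G r"
  define b :: "'a \<Rightarrow> 'a \<Rightarrow> bit" where
    "b x y = of_bool (x = y \<or> ((x, y) \<in> r \<and> x \<noteq> y \<and> (x, y) \<in> parcs G))" for x y
  define B where "B u w = (\<Sum>x\<in>u. \<Sum>y\<in>w. b x y)" for u w
  have Q: "qf ?V u = B u u" if "finite u" for u
  proof -
    have "B u u = (\<Sum>(x, y)\<in>u \<times> u. b x y)"
      unfolding B_def by (rule sum.cartesian_product)
    also have "\<dots> = of_nat (card {(x, y) \<in> u \<times> u.
        x = y \<or> ((x, y) \<in> r \<and> x \<noteq> y \<and> (x, y) \<in> parcs G)})"
      unfolding b_def split_def
      by (subst sum_of_bool_eq) (use that in \<open>auto simp: Int_def intro!: arg_cong[of _ _ card]\<close>)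
    finally show ?thesis by (simp add: universal_embedding_def)
  qed
  have Bl: "B ((u - w) \<union> (w - u)) z = B u z + B w z" if "finite u" "finite w" for u w z
    unfolding B_def by (rule sum_symdiff_bit[OF that])
  have Br: "B z ((u - w) \<union> (w - u)) = B z u + B z w" if "finite u" "finite w" for u w z
    unfolding B_def by (simp only: sum_symdiff_bit[OF that] sum.distrib)
  have f: "bil ?V u w = B u w + B w u" if "finite u" "finite w" for u w
  proof -
    have "u \<otimes>\<^bsub>?V\<^esub> w = (u - w) \<union> (w - u)" by (simp add: universal_embedding_def)
    then show ?thesis
      using that by (simp add: bil_def Q Bl Br ac_simps)
  qed
  have cg: "comm_group ?V"
  proof (rule comm_groupI)
    fix x assume "x \<in> carrier ?V"
    then show "\<exists>y\<in>carrier ?V. y \<otimes>\<^bsub>?V\<^esub> x = \<one>\<^bsub>?V\<^esub>"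
      by (intro bexI[of _ x]) (auto simp: universal_embedding_def)
  qed (auto simp: universal_embedding_def)
  show ?thesis
  proof (intro orthogonal_space.intro cg orthogonal_space_axioms.intro)
    show "qf ?V \<one>\<^bsub>?V\<^esub> = 0" by (simp add: universal_embedding_def)
    show "v \<otimes>\<^bsub>?V\<^esub> v = \<one>\<^bsub>?V\<^esub>" for v by (simp add: universal_embedding_def)
  next
    fix u v w assume *: "u \<in> carrier ?V" "v \<in> carrier ?V" "w \<in> carrier ?V"
    then have fin: "finite u" "finite v" "finite w" by (auto simp: universal_embedding_def)
    have m: "x \<otimes>\<^bsub>?V\<^esub> y = (x - y) \<union> (y - x)" for x y by (simp add: universal_embedding_def)
    show "bil ?V (u \<otimes>\<^bsub>?V\<^esub> v) w = bil ?V u w + bil ?V v w"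
      using fin by (simp add: m f Bl Br ac_simps)
    show "bil ?V u (v \<otimes>\<^bsub>?V\<^esub> w) = bil ?V u v + bil ?V u w"
      using fin by (simp add: m f Bl Br ac_simps)
  qed
qed

context orthogonal_space
begin

lemma qf_add: "qf V (u \<otimes> w) = qf V u + qf V w + bil V u w"
  unfolding bil_def by (simp add: ac_simps)

lemma subgroup_isotropic_radical: "subgroup (isotropic_radical V) V"
proof (rule subgroupI)
  have "bil V \<one> w = 0" if "w \<in> carrier V" for w
    using that bil_add_left[of \<one> \<one> w] by simp
  then show "isotropic_radical V \<noteq> {}"
    unfolding isotropic_radical_def using qf_zero by blast
next
  fix a assume a: "a \<in> isotropic_radical V"
  then have "inv a = a"
    using exponent_two by (intro inv_equality) (auto simp: isotropic_radical_def)
  with a show "inv a \<in> isotropic_radical V" by simp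
qed (auto simp: isotropic_radical_def qf_add bil_add_left)

lemma qf_radical_quotient:
  assumes "v \<in> carrier V"
  shows "qf (radical_quotient V) (isotropic_radical V #> v) = qf V v"
proof -
  have "qf V (a \<otimes> v) = qf V v" if "a \<in> isotropic_radical V" for a
    using that assms by (simp add: qf_add isotropic_radical_def)
  moreover have "isotropic_radical V \<noteq> {}"
    using subgroup.one_closed[OF subgroup_isotropic_radical] by auto
  ultimately have "qf V ` (isotropic_radical V #> v) = {qf V v}"
    unfolding r_coset_def by (auto simp: image_UN)
  then show ?thesis by (simp add: radical_quotient_def Let_def)
qed

lemma carrier_radical_quotient:
  "carrier (radical_quotient V) = (\<lambda>v. isotropic_radical V #> v) ` carrier V"
  by (auto simp: radical_quotient_def Let_def FactGroup_def RCOSETS_def)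

lemma mult_radical_quotient:
  assumes "u \<in> carrier V" "v \<in> carrier V"
  shows "(isotropic_radical V #> u) \<otimes>\<^bsub>radical_quotient V\<^esub> (isotropic_radical V #> v)
    = isotropic_radical V #> (u \<otimes> v)"
proof -
  interpret N: normal "isotropic_radical V" V
    using subgroup_isotropic_radical by (rule subgroup_imp_normal)
  show ?thesis
    using N.rcos_sum[OF assms] by (simp add: radical_quotient_def Let_def FactGroup_def)
qed

lemma one_radical_quotient: "\<one>\<^bsub>radical_quotient V\<^esub> = isotropic_radical V #> \<one>"
  using coset_mult_one[OF subgroup.subset[OF subgroup_isotropic_radical]]
  by (simp add: radical_quotient_def Let_def FactGroup_def)

lemma bil_radical_quotient:
  assumes "u \<in> carrier V" "v \<in> carrier V"
  shows "bil (radical_quotient V) (isotropic_radical V #> u) (isotropic_radical V #> v)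
    = bil V u v"
  using assms by (simp add: bil_def mult_radical_quotient qf_radical_quotient)

theorem orthogonal_space_radical_quotient: "orthogonal_space (radical_quotient V)"
proof -
  have cg: "comm_group (radical_quotient V)"
  proof (rule comm_groupI)
    fix x assume "x \<in> carrier (radical_quotient V)"
    then show "\<exists>y\<in>carrier (radical_quotient V).
        y \<otimes>\<^bsub>radical_quotient V\<^esub> x = \<one>\<^bsub>radical_quotient V\<^esub>"
      by (intro bexI[of _ x])
        (auto simp: carrier_radical_quotient mult_radical_quotient one_radical_quotient
          exponent_two)
  qed (auto simp: carrier_radical_quotient mult_radical_quotient one_radical_quotient
      m_ac)
  show ?thesis
    by (intro orthogonal_space.intro cg orthogonal_space_axioms.intro)
      (auto simp: carrier_radical_quotient mult_radical_quotient one_radical_quotient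
        exponent_two qf_radical_quotient qf_zero bil_radical_quotient bil_add_left bil_add_right)
qed

end

corollary orthogonal_space_minimal_embedding: "orthogonal_space (minimal_embedding G r)"
  unfolding minimal_embedding_def
  by (intro orthogonal_space.orthogonal_space_radical_quotient
      orthogonal_space_universal_embedding)

lemma minimal_image_anisotropic:
  "minimal_image G r \<subseteq> anisotropic (minimal_embedding G r)"
proof -
  let ?V = "universal_embedding G r"
  interpret orthogonal_space ?V by (rule orthogonal_space_universal_embedding)
  have c: "{v} \<in> carrier ?V" if "v \<in> pverts G" for v
    using that by (simp add: universal_embedding_def)
  have "{(x, y) \<in> {v} \<times> {v}. x = y \<or> ((x, y) \<in> r \<and> x \<noteq> y \<and> (x, y) \<in> parcs G)} = {(v, v)}" for v
    by auto
  then have "qf ?V {v} = 1" for v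
    by (simp add: universal_embedding_def)
  with c show ?thesis
    by (auto simp: minimal_image_def Let_def anisotropic_def minimal_embedding_def
        carrier_radical_quotient qf_radical_quotient)
qed

end

theory Submission
  imports Defs
begin

text \<open>
  Both sides say that the vectors of \<open>\<Gamma>\<close> are edges \<open>s\<^sub>i + s\<^sub>j\<close> for a family \<open>s\<close> of
  vectors with \<open>Q(s\<^sub>i + s\<^sub>j) = 1\<close> whenever \<open>i \<noteq> j\<close>; then \<open>f\<close> of two edges is the
  parity of the number of common ends.

  If a path \<open>w\<^sub>0, \<dots>, w\<^sub>n\<^sub>-\<^sub>1\<close> is given, its prefix sums form such a family, and the set of
  all edges is closed under reflections in edges. Hence elementary transformations, forwards or
  backwards, stay inside this set, and the edges representing the vertices of \<open>\<Gamma>\<close> form the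
  required multi-graph.

  Conversely, sending an edge of a multi-graph to its set of ends extends to a boundary map on
  \<open>V\<^sub>\<Gamma>\<close>. The form \<open>Q\<^sub>\<Gamma>\<close> is half the size of the boundary, so everything
  with empty boundary lies in the isotropic radical, and \<open>s\<^sub>i\<close> can be taken to be the class of a
  set with boundary \<open>{z, i}\<close> for a fixed \<open>z\<close>. An elementary transformation now slides one end
  of an edge along an adjacent edge. As long as some vertex is missed by a path, an edge leaving the
  path can be slid to its last vertex and prolongs it. Once the path is Hamiltonian, every other edge
  can be slid along it until it merges with an edge that is already present.
\<close>

section \<open>Vectors as edges of a graph\<close>

context orthogonal_space
begin

lemma bil_commute:
  assumes "u \<in> carrier V" "w \<in> carrier V"
  shows "bil V u w = bil V w u"
  using assms by (simp add: bil_def m_comm ac_simps)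

lemma bil_self:
  assumes "v \<in> carrier V"
  shows "bil V v v = 0"
  using assms by (simp add: bil_def exponent_two qf_zero)

lemma bil_zero_left:
  assumes "w \<in> carrier V"
  shows "bil V \<one> w = 0"
  using assms bil_add_left[of \<one> \<one> w] by simp

lemma add_cancel:
  assumes "u \<in> carrier V" "w \<in> carrier V"
  shows "u \<otimes> (u \<otimes> w) = w"
  using assms by (simp add: m_assoc[symmetric] exponent_two)

lemma add_right_cancel:
  assumes "u \<in> carrier V" "w \<in> carrier V"
  shows "w \<otimes> u \<otimes> u = w"
  using assms by (simp add: m_assoc exponent_two)

end

text \<open>Only sums of two frame vectors are constrained; \<open>Q\<close> of a single
  \<open>s i\<close> is left free, so the family may be translated. The index set is a parameter
  because the reduction to a path takes place in a frame on a subset of \<open>X\<close>.\<close>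

locale root_frame = orthogonal_space V for V :: "'v quad_space" (structure) +
  fixes s :: "'i \<Rightarrow> 'v" and X :: "'i set"
  assumes frame_closed: "i \<in> X \<Longrightarrow> s i \<in> carrier V"
    and qf_frame: "\<lbrakk>i \<in> X; j \<in> X\<rbrakk> \<Longrightarrow> qf V (s i \<otimes> s j) = of_bool (i \<noteq> j)"
begin

definition edge :: "'i \<Rightarrow> 'i \<Rightarrow> 'v" where
  "edge i j = s i \<otimes> s j"

definition edges :: "'i set \<Rightarrow> 'v set" where
  "edges Y = {edge i j | i j. i \<in> Y \<and> j \<in> Y \<and> i \<noteq> j}"

text \<open>Connectedness of the graph on \<open>Z\<close> formed by the edges in \<open>W\<close>.
  Stated through cuts, it survives a transformation because each crossing edge can be replaced
  locally.\<close>

definition crosses_cuts :: "'i set \<Rightarrow> 'v set \<Rightarrow> bool" where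
  "crosses_cuts Z W \<longleftrightarrow>
     (\<forall>Y. Y \<subset> Z \<longrightarrow> Y \<noteq> {} \<longrightarrow> (\<exists>i\<in>Y. \<exists>j\<in>Z - Y. edge i j \<in> W))"

text \<open>An edge vector then determines its two ends. This can fail, since four frame vectors may
  sum to zero.\<close>

definition edge_injective :: "'i set \<Rightarrow> bool" where
  "edge_injective Y \<longleftrightarrow> (\<forall>i\<in>Y. \<forall>j\<in>Y. \<forall>k\<in>Y. \<forall>l\<in>Y.
     i \<noteq> j \<longrightarrow> k \<noteq> l \<longrightarrow> edge i j = edge k l \<longrightarrow> {i, j} = {k, l})"

lemma edge_closed [simp]: "\<lbrakk>i \<in> X; j \<in> X\<rbrakk> \<Longrightarrow> edge i j \<in> carrier V"
  by (simp add: edge_def frame_closed)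

lemma edge_commute: "\<lbrakk>i \<in> X; j \<in> X\<rbrakk> \<Longrightarrow> edge i j = edge j i"
  by (simp add: edge_def frame_closed m_comm)

lemma edge_add: "\<lbrakk>i \<in> X; j \<in> X; k \<in> X\<rbrakk> \<Longrightarrow> edge i j \<otimes> edge j k = edge i k"
  by (simp add: edge_def frame_closed m_assoc add_cancel)

lemma qf_edge: "\<lbrakk>i \<in> X; j \<in> X\<rbrakk> \<Longrightarrow> qf V (edge i j) = of_bool (i \<noteq> j)"
  by (simp add: edge_def qf_frame)

lemma bil_edge:
  assumes "i \<in> X" "j \<in> X" "k \<in> X" "l \<in> X"
  shows "bil V (edge i j) (edge k l) =
    of_bool (i \<noteq> k) + of_bool (i \<noteq> l) + of_bool (j \<noteq> k) + of_bool (j \<noteq> l)"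
proof -
  \<comment> \<open>After expanding by bilinearity, each \<open>Q (s a)\<close> occurs twice and
    cancels.\<close>
  have "bil V (s a) (s b) = of_bool (a \<noteq> b) + qf V (s a) + qf V (s b)" if "a \<in> X" "b \<in> X" for a b
    using that by (simp add: bil_def qf_frame)
  then show ?thesis
    using assms by (simp add: edge_def frame_closed bil_add_left bil_add_right ac_simps)
qed

text \<open>Of the four comparisons of ends, the unequal ones and the coincidences have the same
  parity. Two edges have 0, 1 or 2 common ends, and only 1 is odd.\<close>

lemma bil_edge_eq_1_iff:
  assumes "i \<in> X" "j \<in> X" "k \<in> X" "l \<in> X" "i \<noteq> j" "k \<noteq> l"
  shows "bil V (edge i j) (edge k l) = 1 \<longleftrightarrow> card ({i, j} \<inter> {k, l}) = 1"
  unfolding bil_edge[OF assms(1-4)] using assms(5,6)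
  by (cases "i = k"; cases "i = l"; cases "j = k"; cases "j = l") (auto simp: Int_insert_left)

lemma adjacent_edgeE:
  assumes v: "v \<in> edges X" and X: "k \<in> X" "l \<in> X" "k \<noteq> l" and b: "bil V v (edge k l) = 1"
  obtains (left) m where "m \<in> X" "m \<noteq> k" "m \<noteq> l" "v = edge m k"
  | (right) m where "m \<in> X" "m \<noteq> k" "m \<noteq> l" "v = edge m l"
proof -
  obtain i j where ij: "v = edge i j" "i \<in> X" "j \<in> X" "i \<noteq> j"
    using v unfolding edges_def by blast
  have "card ({i, j} \<inter> {k, l}) = 1"
    using b ij X by (simp add: bil_edge_eq_1_iff)
  then have "(i = k \<and> j \<noteq> l) \<or> (i = l \<and> j \<noteq> k) \<or> (j = k \<and> i \<noteq> l) \<or> (j = l \<and> i \<noteq> k)"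
    using ij(4) X(3) by (auto simp: Int_insert_left split: if_splits)
  then show thesis
    using ij X left right edge_commute by metis
qed

lemma edgesI: "\<lbrakk>i \<in> Y; j \<in> Y; i \<noteq> j\<rbrakk> \<Longrightarrow> edge i j \<in> edges Y"
  unfolding edges_def by blast

lemma edges_anisotropic: "edges X \<subseteq> anisotropic V"
  by (auto simp: edges_def anisotropic_def qf_edge)

lemma edges_closed: "v \<in> edges X \<Longrightarrow> v \<in> carrier V"
  by (auto simp: edges_def)

text \<open>Two edges with one common end sum to the third side of their triangle.\<close>

lemma edges_reflection:
  assumes v: "v \<in> edges X" and w: "w \<in> edges X"
  shows "w \<otimes> scal V (bil V v w) v \<in> edges X"
proof (cases "bil V v w = 1")
  case True
  obtain k l where kl: "w = edge k l" "k \<in> X" "l \<in> X" "k \<noteq> l"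
    using w unfolding edges_def by blast
  show ?thesis
    using v kl(2-4) True[unfolded kl(1)]
  proof (cases rule: adjacent_edgeE)
    case (left m)
    then have "w \<otimes> v = edge l m"
      using kl edge_add[of l k m] edge_commute by metis
    with left kl True show ?thesis by (auto simp: scal_def intro: edgesI)
  next
    case (right m)
    then have "w \<otimes> v = edge k m"
      using kl edge_add[of k l m] edge_commute by metis
    with right kl True show ?thesis by (auto simp: scal_def intro: edgesI)
  qed
next
  case False
  then show ?thesis using w by (simp add: scal_def edges_closed)
qed

section \<open>Stability under elementary transformations\<close>

lemma elementary_transformation_edges:
  assumes "elementary_transformation V W W'" "W \<subseteq> edges X"
  shows "W' \<subseteq> edges X"
  using assms edges_reflection unfolding elementary_transformation_def by blast

lemma elementary_transformations_edges:
  assumes "(elementary_transformation V)\<^sup>*\<^sup>* W W'" "W \<subseteq> edges X"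
  shows "W' \<subseteq> edges X"
  using assms by (induction rule: rtranclp_induct) (auto dest: elementary_transformation_edges)

text \<open>A transformation is a reflection in a vector that survives it, so it can be undone.\<close>

lemma elementary_transformation_edges_converse:
  assumes "elementary_transformation V W W'" "W' \<subseteq> edges X" "W \<subseteq> carrier V"
  shows "W \<subseteq> edges X"
proof -
  obtain v w where vw: "v \<in> W" "w \<in> W" "W' = (W - {w}) \<union> {w \<otimes> scal V (bil V v w) v}"
    using assms(1) unfolding elementary_transformation_def by blast
  have c: "v \<in> carrier V" "w \<in> carrier V" using vw assms(3) by auto
  define w' where "w' = w \<otimes> scal V (bil V v w) v"
  have w': "w' \<in> edges X" using vw assms(2) by (auto simp: w'_def)
  have "w \<in> edges X"
  proof (cases "bil V v w = 1")
    case True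
    then have "v \<noteq> w" using bil_self c by auto
    then have v: "v \<in> edges X" using vw assms(2) by auto
    have "w' = w \<otimes> v" using True by (simp add: w'_def scal_def)
    moreover have "bil V v (w \<otimes> v) = 1" using True c by (simp add: bil_add_right bil_self)
    ultimately have "w' \<otimes> scal V (bil V v w') v = w"
      using c by (simp add: scal_def add_right_cancel)
    then show ?thesis using edges_reflection[OF v w'] by simp
  next
    case False
    then show ?thesis using w' c by (simp add: w'_def scal_def)
  qed
  then show ?thesis using vw(3) assms(2) by auto
qed

text \<open>Membership in \<open>edges X\<close> is pulled back from \<open>W'\<close>, whereas the
  inclusion in \<open>carrier V\<close> is carried forward from \<open>W\<close>; the induction runs
  backwards with both.\<close>

lemma elementary_transformations_edges_converse:
  assumes "(elementary_transformation V)\<^sup>*\<^sup>* W W'" "W' \<subseteq> edges X" "W \<subseteq> carrier V"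
  shows "W \<subseteq> edges X"
  using assms
proof (induction rule: converse_rtranclp_induct)
  case (step W1 W2)
  have "W2 \<subseteq> carrier V"
    using step.hyps(1) step.prems(2) unfolding elementary_transformation_def
    by (auto simp: scal_def subset_iff)
  then show ?case
    using step elementary_transformation_edges_converse by blast
qed

text \<open>A crossing edge is lost only if it is \<open>w\<close> itself and is replaced by
  \<open>w + v\<close>. Then \<open>v\<close> and \<open>w + v\<close> are the other two sides of a
  triangle on \<open>w\<close> with apex \<open>m\<close>, and one of them crosses the cut,
  whichever side contains \<open>m\<close>.\<close>

lemma crosses_cuts_elementary_transformation:
  assumes t: "elementary_transformation V W W'" and W: "W \<subseteq> edges X" and cr: "crosses_cuts X W"
  shows "crosses_cuts X W'"
  unfolding crosses_cuts_def
proof (intro allI impI)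
  fix Y assume Y: "Y \<subset> X" "Y \<noteq> {}"
  obtain v w where vw: "v \<in> W" "w \<in> W" "W' = (W - {w}) \<union> {w \<otimes> scal V (bil V v w) v}"
    using t unfolding elementary_transformation_def by blast
  obtain i j where ij: "i \<in> Y" "j \<in> X - Y" "edge i j \<in> W"
    using cr Y unfolding crosses_cuts_def by blast
  then have ijX: "i \<in> X" "j \<in> X" "i \<noteq> j" using Y by auto
  show "\<exists>i\<in>Y. \<exists>j\<in>X - Y. edge i j \<in> W'"
  proof (cases "edge i j = w \<and> bil V v w = 1")
    case False
    then have "edge i j \<in> W'"
      using vw ij ijX by (cases "edge i j = w") (auto simp: scal_def)
    then show ?thesis using ij by blast
  next
    case True
    then have w': "w \<otimes> v \<in> W'" using vw by (auto simp: scal_def)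
    have "v \<noteq> w" using True bil_self edges_closed W vw by auto
    then have v': "v \<in> W'" using vw by auto
    have v: "v \<in> edges X" "bil V v (edge i j) = 1" using True W vw by auto
    show ?thesis
      using v(1) ijX v(2)
    proof (cases rule: adjacent_edgeE)
      case (left m)
      then have "w \<otimes> v = edge m j"
        using True ijX edge_add[of j i m] edge_commute by metis
      moreover have "v = edge i m" using left ijX edge_commute by metis
      ultimately have "edge m j \<in> W'" "edge i m \<in> W'" using v' w' by simp_all
      then show ?thesis using left(1) ij(1,2) by blast
    next
      case (right m)
      then have "w \<otimes> v = edge i m"
        using True ijX edge_add[of i j m] edge_commute by metis
      then have "edge i m \<in> W'" "edge m j \<in> W'" using v' w' right(4) by simp_all
      then show ?thesis using right(1) ij(1,2) by blast
    qed
  qed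
qed

lemma crosses_cuts_elementary_transformations:
  assumes "(elementary_transformation V)\<^sup>*\<^sup>* W W'" "W \<subseteq> edges X" "crosses_cuts X W"
  shows "crosses_cuts X W'"
  using assms
proof (induction rule: rtranclp_induct)
  case (step W1 W2)
  show ?case
    using crosses_cuts_elementary_transformation[OF step.hyps(2)]
      elementary_transformations_edges[OF step.hyps(1) step.prems(1)] step.IH[OF step.prems]
    by blast
qed

section \<open>Sliding edges along a path\<close>

lemma slide_edge:
  assumes X: "a \<in> X" "b \<in> X" "c \<in> X" "a \<noteq> b" "b \<noteq> c" "a \<noteq> c"
    and W: "edge a b \<in> W" "edge b c \<in> W"
  shows "elementary_transformation V W (insert (edge a c) (W - {edge b c}))"
proof -
  have "bil V (edge a b) (edge b c) = 1"
    using X by (simp add: bil_edge)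
  moreover have "edge b c \<otimes> edge a b = edge a c"
    using X edge_add[of a b c] by (simp add: m_comm)
  ultimately show ?thesis
    unfolding elementary_transformation_def using W
    by (intro bexI[of _ "edge a b"] bexI[of _ "edge b c"]) (auto simp: scal_def)
qed

definition path_edges :: "'i list \<Rightarrow> 'v set" where
  "path_edges p = {edge (p ! i) (p ! Suc i) | i. Suc i < length p}"

lemma path_edgesI: "Suc i < length p \<Longrightarrow> edge (p ! i) (p ! Suc i) \<in> path_edges p"
  unfolding path_edges_def by blast

lemma path_edges_snoc:
  assumes "p \<noteq> []"
  shows "path_edges (p @ [q]) = insert (edge (last p) q) (path_edges p)"
proof (intro equalityI subsetI)
  fix v assume "v \<in> path_edges (p @ [q])"
  then obtain i where i: "v = edge ((p @ [q]) ! i) ((p @ [q]) ! Suc i)" "i < length p"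
    unfolding path_edges_def by auto
  show "v \<in> insert (edge (last p) q) (path_edges p)"
  proof (cases "Suc i < length p")
    case True
    then show ?thesis using i by (simp add: nth_append path_edgesI)
  next
    case False
    then have "i = length p - 1" "Suc i = length p" using i by auto
    then show ?thesis using i assms by (simp add: nth_append last_conv_nth)
  qed
next
  fix v assume v: "v \<in> insert (edge (last p) q) (path_edges p)"
  show "v \<in> path_edges (p @ [q])"
  proof (cases "v \<in> path_edges p")
    case True
    then obtain i where i: "v = edge (p ! i) (p ! Suc i)" "Suc i < length p"
      unfolding path_edges_def by blast
    then show ?thesis using path_edgesI[of i "p @ [q]"] by (simp add: nth_append)
  next
    case False
    then show ?thesis
      using v assms path_edgesI[of "length p - 1" "p @ [q]"]
      by (simp add: nth_append last_conv_nth)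
  qed
qed

lemma slide_to_end_of_path:
  assumes inj: "edge_injective X"
    and p: "distinct p" "set p \<subseteq> X" and q: "q \<in> X" "q \<notin> set p"
    and W: "path_edges p \<subseteq> W" "edge (p ! i) q \<in> W" and ij: "i \<le> j" "j < length p"
  shows "\<exists>W'. (elementary_transformation V)\<^sup>*\<^sup>* W W' \<and> path_edges p \<subseteq> W' \<and> edge (p ! j) q \<in> W'"
  using ij
proof (induction rule: dec_induct)
  case base
  then show ?case using W by blast
next
  case (step j)
  then obtain W' where W': "(elementary_transformation V)\<^sup>*\<^sup>* W W'" "path_edges p \<subseteq> W'"
    "edge (p ! j) q \<in> W'" by auto
  have pj: "p ! j \<in> set p" "p ! Suc j \<in> set p" "p ! j \<noteq> p ! Suc j"
    using step.prems p by (auto simp: nth_eq_iff_index_eq)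
  then have X: "p ! j \<in> X" "p ! Suc j \<in> X" "p ! j \<noteq> q" "p ! Suc j \<noteq> q" using p q by auto
  have "edge (p ! Suc j) (p ! j) \<in> W'"
    using W'(2) path_edgesI[OF step.prems] edge_commute X by auto
  then have "elementary_transformation V W' (insert (edge (p ! Suc j) q) (W' - {edge (p ! j) q}))"
    using X pj q W' by (intro slide_edge) auto
  \<comment> \<open>The vector removed by the slide is not part of the path: by injectivity its ends
    are determined, and \<open>q\<close> lies off the path.\<close>
  moreover have "edge (p ! j) q \<notin> path_edges p"
  proof
    assume "edge (p ! j) q \<in> path_edges p"
    then obtain k where k: "edge (p ! j) q = edge (p ! k) (p ! Suc k)" "Suc k < length p"
      unfolding path_edges_def by blast
    have pk: "p ! k \<in> set p" "p ! Suc k \<in> set p" "p ! k \<noteq> p ! Suc k"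
      using k p by (auto simp: nth_eq_iff_index_eq)
    then have "p ! k \<in> X" "p ! Suc k \<in> X" using p by auto
    then have "{p ! j, q} = {p ! k, p ! Suc k}"
      using inj X q(1) pk(3) k(1) unfolding edge_injective_def by blast
    then have "q \<in> {p ! k, p ! Suc k}" by blast
    then show False using pk q by auto
  qed
  ultimately show ?case
    using W' by (intro exI[of _ "insert (edge (p ! Suc j) q) (W' - {edge (p ! j) q})"]) auto
qed

text \<open>The vertex set of a path that misses a point is one side of a cut. A vector crossing it
  is slid to the last vertex and appended. Here \<open>n\<close> counts edges, so
  \<open>n = card X - 1\<close> yields a Hamiltonian path.\<close>

lemma exists_long_path:
  assumes inj: "edge_injective X" and X: "finite X" "X \<noteq> {}"
    and W: "W \<subseteq> edges X" "crosses_cuts X W" and n: "n < card X"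
  shows "\<exists>p W'. (elementary_transformation V)\<^sup>*\<^sup>* W W' \<and> distinct p \<and> set p \<subseteq> X \<and>
    length p = Suc n \<and> path_edges p \<subseteq> W'"
  using n
proof (induction n)
  case 0
  obtain x where "x \<in> X" using X by auto
  then show ?case
    by (intro exI[of _ "[x]"] exI[of _ W]) (auto simp: path_edges_def)
next
  case (Suc n)
  then obtain p W' where p: "(elementary_transformation V)\<^sup>*\<^sup>* W W'" "distinct p" "set p \<subseteq> X"
    "length p = Suc n" "path_edges p \<subseteq> W'" by auto
  have "card (set p) < card X" using Suc.prems p by (simp add: distinct_card)
  then have "set p \<subset> X" "set p \<noteq> {}" using p by auto
  then obtain a q where aq: "a \<in> set p" "q \<in> X" "q \<notin> set p" "edge a q \<in> W'"
    using crosses_cuts_elementary_transformations[OF p(1) W] unfolding crosses_cuts_def by blast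
  then obtain i where i: "a = p ! i" "i < length p" by (auto simp: in_set_conv_nth)
  then obtain W'' where W'': "(elementary_transformation V)\<^sup>*\<^sup>* W' W''" "path_edges p \<subseteq> W''"
    "edge (p ! (length p - 1)) q \<in> W''"
    using slide_to_end_of_path[OF inj p(2,3) aq(2,3) p(5), of i "length p - 1"] aq by fastforce
  have "p \<noteq> []" using p by auto
  then have "path_edges (p @ [q]) \<subseteq> W''"
    using W'' by (simp add: path_edges_snoc last_conv_nth)
  then show ?case
    using p aq W'' by (intro exI[of _ "p @ [q]"] exI[of _ W'']) auto
qed

text \<open>A chord slides down the path until it coincides with a vector that is already present.\<close>

lemma merge_chord:
  assumes p: "distinct p" "set p \<subseteq> X" and W: "finite W" "path_edges p \<subseteq> W"
    and chord: "edge (p ! i) (p ! j) \<in> W" "edge (p ! i) (p ! j) \<notin> path_edges p"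
    and ij: "i < j" "j < length p"
  shows "\<exists>W'. (elementary_transformation V)\<^sup>*\<^sup>* W W' \<and> path_edges p \<subseteq> W' \<and> card W' < card W"
  using ij W chord
proof (induction j arbitrary: W)
  case (Suc j)
  \<comment> \<open>A chord between consecutive vertices would be a path edge.\<close>
  have "i \<noteq> j" using Suc.prems path_edgesI[of i p] by auto
  then have ij: "i < j" "j < length p" using Suc.prems by auto
  let ?w = "edge (p ! i) (p ! Suc j)" and ?w' = "edge (p ! i) (p ! j)"
  let ?W = "insert ?w' (W - {?w})"
  have X: "p ! i \<in> X" "p ! j \<in> X" "p ! Suc j \<in> X"
    using ij Suc.prems p by (auto simp: subset_iff)
  have ne: "p ! i \<noteq> p ! j" "p ! i \<noteq> p ! Suc j" "p ! j \<noteq> p ! Suc j"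
    using ij Suc.prems(2) p by (auto simp: nth_eq_iff_index_eq)
  have "edge (p ! j) (p ! Suc j) \<in> W"
    using Suc.prems path_edgesI by auto
  then have "elementary_transformation V W
      (insert (edge (p ! j) (p ! i)) (W - {edge (p ! Suc j) (p ! i)}))"
    using X ne Suc.prems edge_commute[of "p ! i" "p ! Suc j"]
    by (intro slide_edge) auto
  then have t: "elementary_transformation V W ?W"
    using X edge_commute by metis
  have P: "path_edges p \<subseteq> ?W" using Suc.prems by auto
  show ?case
  proof (cases "?w' \<in> W")
    case True
    \<comment> \<open>Equal vectors are orthogonal, but these two edges share exactly the end
      \<open>p ! i\<close>.\<close>
    have "?w' \<noteq> ?w"
    proof
      assume "?w' = ?w"
      then have "bil V ?w' ?w = 0" using X by (simp add: bil_self)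
      then show False using X ne by (simp add: bil_edge)
    qed
    then have "?W = W - {?w}" using True by auto
    then have "card ?W < card W" using Suc.prems by (metis card_Diff1_less)
    then show ?thesis using t P by blast
  next
    \<comment> \<open>The shorter chord is new, so the cardinality is unchanged and the induction
      continues with it. At the latest for consecutive positions the slid vector is a path edge and
      merges.\<close>
    case False
    then have c: "card ?W = card W"
      using card_Suc_Diff1[OF Suc.prems(3,5)] Suc.prems(3) by simp
    have "?w' \<notin> path_edges p" using False Suc.prems by auto
    then have "\<exists>W'. (elementary_transformation V)\<^sup>*\<^sup>* ?W W' \<and> path_edges p \<subseteq> W' \<and> card W' < card ?W"
      using Suc.prems ij P by (intro Suc.IH) auto
    then show ?thesis using t c by (metis converse_rtranclp_into_rtranclp)
  qed
qed simp

text \<open>Since the path visits all of \<open>X\<close>, every vector outside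
  \<open>path_edges p\<close> is a chord. Merging it lowers \<open>card W\<close>, which drives the
  induction.\<close>

lemma reduce_to_path:
  assumes p: "distinct p" "set p = X" and W: "W \<subseteq> edges X" "path_edges p \<subseteq> W"
  shows "(elementary_transformation V)\<^sup>*\<^sup>* W (path_edges p)"
  using W
proof (induction "card W" arbitrary: W rule: less_induct)
  case less
  have "edges X \<subseteq> (\<lambda>(i, j). edge i j) ` (X \<times> X)"
    unfolding edges_def by auto
  moreover have "finite X" using p by auto
  ultimately have "finite (edges X)" by (meson finite_SigmaI finite_imageI finite_subset)
  then have fin: "finite W" using less.prems finite_subset by blast
  show ?case
  proof (cases "W = path_edges p")
    case False
    then obtain a b where ab: "a \<in> X" "b \<in> X" "a \<noteq> b" "edge a b \<in> W" "edge a b \<notin> path_edges p"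
      using less.prems unfolding edges_def by blast
    then obtain i j where ij: "a = p ! i" "b = p ! j" "i < length p" "j < length p"
      using p by (metis in_set_conv_nth)
    obtain k l where kl: "k < l" "l < length p" "edge (p ! k) (p ! l) = edge a b"
      using ij ab edge_commute by (metis nat_neq_iff)
    then obtain W' where W': "(elementary_transformation V)\<^sup>*\<^sup>* W W'" "path_edges p \<subseteq> W'"
      "card W' < card W"
      using merge_chord[OF p(1) _ fin less.prems(2), of k l] ab p by auto
    then have "(elementary_transformation V)\<^sup>*\<^sup>* W' (path_edges p)"
      using less.hyps elementary_transformations_edges[OF W'(1) less.prems(1)] by blast
    with W'(1) show ?thesis by (rule rtranclp_trans)
  qed simp
qed

text \<open>
  The only coincidences among edges are \<open>s\<^sub>i + s\<^sub>j = s\<^sub>k + s\<^sub>l\<close> with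
  \<open>X = {i, j, k, l}\<close>, and then \<open>l\<close> can be dropped from the frame.
\<close>

lemma exists_edge_injective_subframe:
  assumes W: "W \<subseteq> edges X" "crosses_cuts X W" and ne: "X \<noteq> {}"
  shows "\<exists>Z \<subseteq> X. Z \<noteq> {} \<and> edge_injective Z \<and> W \<subseteq> edges Z \<and> crosses_cuts Z W"
proof (cases "edge_injective X")
  case True
  then show ?thesis using assms by blast
next
  case False
  then obtain i j k l where X: "i \<in> X" "j \<in> X" "k \<in> X" "l \<in> X"
    and ne: "i \<noteq> j" "k \<noteq> l" "{i, j} \<noteq> {k, l}" and eq: "edge i j = edge k l"
    unfolding edge_injective_def by blast
  have "bil V (edge i j) (edge k l) = 0"
    unfolding eq using X by (simp add: bil_self)
  \<comment> \<open>An even number of common ends, and not both since the pairs differ: the two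
    edges are disjoint.\<close>
  then have dist: "i \<noteq> k" "i \<noteq> l" "j \<noteq> k" "j \<noteq> l"
    using X ne unfolding bil_edge[OF X] by (auto simp: of_bool_def split: if_splits)
  have X4: "X = {i, j, k, l}"
  proof (rule ccontr)
    assume "X \<noteq> {i, j, k, l}"
    then obtain m where m: "m \<in> X" "m \<notin> {i, j, k, l}" using X by blast
    \<comment> \<open>With a fifth point \<open>m\<close>, the edge \<open>im\<close> would separate
      the equal vectors \<open>ij\<close> and \<open>kl\<close> through \<open>f\<close>.\<close>
    have "bil V (edge i j) (edge i m) = 1" "bil V (edge k l) (edge i m) = 0"
      using X m ne dist by (auto simp: bil_edge)
    then show False using eq by simp
  qed
  \<comment> \<open>One coincidence forces all three pairs of opposite edges of the tetrahedron
    \<open>ijkl\<close> to coincide, so only the sides of the triangle \<open>ijk\<close>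
    remain.\<close>
  have eq2: "edge k l = edge i j" using eq by simp
  have "edge j l = edge j i \<otimes> edge i l"
    using X by (simp add: edge_add)
  also have "\<dots> = edge k l \<otimes> edge l i"
    using X eq edge_commute by (metis)
  finally have eq3: "edge j l = edge i k"
    using X edge_add edge_commute by metis
  have "edge i l = edge i j \<otimes> edge j l"
    using X by (simp add: edge_add)
  also have "\<dots> = edge j i \<otimes> edge i k"
    using X eq3 edge_commute by metis
  finally have eq4: "edge i l = edge j k"
    using X by (simp add: edge_add)
  have com: "edge j i = edge i j" "edge k i = edge i k" "edge l i = edge i l"
    "edge k j = edge j k" "edge l j = edge j l" "edge l k = edge k l"
    using X edge_commute by blast+
  note red = com eq2 eq3 eq4
  let ?Z = "{i, j, k}"
  have "edges X \<subseteq> edges ?Z"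
    unfolding edges_def X4 using ne dist red by fastforce
  moreover have "edge_injective ?Z"
    unfolding edge_injective_def
  proof (intro ballI impI)
    fix a b c d assume Z: "a \<in> ?Z" "b \<in> ?Z" "c \<in> ?Z" "d \<in> ?Z"
      and "a \<noteq> b" "c \<noteq> d" and e: "edge a b = edge c d"
    have XX: "a \<in> X" "b \<in> X" "c \<in> X" "d \<in> X" using Z X by auto
    \<comment> \<open>Distinct pairs out of three points share exactly one point, which would give
      \<open>f = 1\<close>.\<close>
    have "bil V (edge a b) (edge c d) = 0" unfolding e using XX by (simp add: bil_self)
    then show "{a, b} = {c, d}"
      using Z \<open>a \<noteq> b\<close> \<open>c \<noteq> d\<close> unfolding bil_edge[OF XX]
      by (auto simp: of_bool_def split: if_splits)
  qed
  moreover have "crosses_cuts ?Z W"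
  proof -
    have cut: "\<exists>a\<in>Y. \<exists>b\<in>X - Y. edge a b \<in> W" 
      if "Y \<subseteq> X" "Y \<noteq> {}" "c \<in> X" "c \<notin> Y" for Y c
      using W(2) that unfolding crosses_cuts_def by blast
    \<comment> \<open>The four edges across a cut of \<open>X\<close> into two pairs reduce to two
      sides of the triangle. The three such cuts put at least two sides into \<open>W\<close>, which
      connects the triangle.\<close>
    have c1: "edge i j \<in> W \<or> edge i k \<in> W"
      using cut[of "{i, l}" j] X ne dist unfolding X4 by (auto simp: red)
    have c2: "edge i j \<in> W \<or> edge j k \<in> W"
      using cut[of "{j, l}" i] X ne dist unfolding X4 by (auto simp: red)
    have c3: "edge i k \<in> W \<or> edge j k \<in> W"
      using cut[of "{k, l}" i] X ne dist unfolding X4 by (auto simp: red)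
    show ?thesis
      unfolding crosses_cuts_def
    proof (intro allI impI)
      fix Y assume Y: "Y \<subset> ?Z" "Y \<noteq> {}"
      have com': "edge j i \<in> W \<longleftrightarrow> edge i j \<in> W" "edge k i \<in> W \<longleftrightarrow> edge i k \<in> W"
        "edge k j \<in> W \<longleftrightarrow> edge j k \<in> W"
        using com by simp_all
      consider "Y = {i}" | "Y = {j}" | "Y = {k}" | "Y = {i, j}" | "Y = {i, k}" | "Y = {j, k}"
        using Y by blast
      then show "\<exists>a\<in>Y. \<exists>b\<in>?Z - Y. edge a b \<in> W"
        by cases (use ne dist c1 c2 c3 com' in auto)
    qed
  qed
  ultimately show ?thesis
    using W X by (intro exI[of _ ?Z]) auto
qed

section \<open>Reaching the path graph\<close>

lemma induced_graph_path_edges: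
  assumes inj: "edge_injective X" and p: "distinct p" "set p \<subseteq> X"
  shows "digraph_iso (with_proj (induced_graph V (path_edges p)))
    (with_proj (path_graph (length p - 1)))"
proof -
  let ?n = "length p - 1"
  define g where "g i = edge (p ! i) (p ! Suc i)" for i
  have g: "path_edges p = g ` {..<?n}"
    by (auto simp: path_edges_def g_def)
  have pX: "p ! i \<in> X" if "i < length p" for i using p that by auto
  have bil_g: "bil V (g i) (g j) = of_bool (j = Suc i \<or> i = Suc j)" if "i < ?n" "j < ?n" for i j
    using that p unfolding g_def
    by (subst bil_edge) (auto simp: pX nth_eq_iff_index_eq of_bool_def)
  have gi: "inj_on g {..<?n}"
  proof (rule inj_onI)
    fix i j assume ij: "i \<in> {..<?n}" "j \<in> {..<?n}" "g i = g j"
    have "p ! i \<noteq> p ! Suc i" "p ! j \<noteq> p ! Suc j"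
      using ij p by (auto simp: nth_eq_iff_index_eq)
    then have "{p ! i, p ! Suc i} = {p ! j, p ! Suc j}"
      using inj ij pX unfolding edge_injective_def g_def by simp
    \<comment> \<open>The crosswise match of the pairs would require both \<open>i = Suc j\<close>
      and \<open>j = Suc i\<close>.\<close>
    then show "i = j"
      using ij p by (auto simp: doubleton_eq_iff nth_eq_iff_index_eq)
  qed
  have gE: "g i \<in> edges X" if "i < ?n" for i
    using that p unfolding g_def by (intro edgesI) (auto simp: pX nth_eq_iff_index_eq)
  have adj: "g i \<noteq> g j \<and> qf V (g i \<otimes> g j) = 1 \<longleftrightarrow> j = Suc i \<or> i = Suc j"
    if "i < ?n" "j < ?n" for i j
  proof -
    have "qf V (g i) = 1" "qf V (g j) = 1"
      using gE[OF that(1)] gE[OF that(2)] edges_anisotropic by (auto simp: anisotropic_def)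
    \<comment> \<open>The two values \<open>Q = 1\<close> cancel, so adjacency in the induced graph
      is \<open>f = 1\<close>.\<close>
    then have "qf V (g i \<otimes> g j) = bil V (g i) (g j)" by (simp add: qf_add)
    moreover have "g i = g j \<longleftrightarrow> i = j" using gi that by (auto simp: inj_on_def)
    ultimately show ?thesis using bil_g[OF that] by auto
  qed
  define h where "h = the_inv_into {..<?n} g"
  have hg: "h (g i) = i" if "i < ?n" for i
    using gi that by (simp add: h_def the_inv_into_f_f)
  show ?thesis
  proof (rule digraph_iso_with_projI[where h = h])
    show "parcs (induced_graph V (path_edges p))
        \<subseteq> pverts (induced_graph V (path_edges p)) \<times> pverts (induced_graph V (path_edges p))"
      by (auto simp: induced_graph_def)
    show "bij_betw h (pverts (induced_graph V (path_edges p))) (pverts (path_graph ?n))"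
      using bij_betw_the_inv_into[of g "{..<?n}"] gi
      by (simp add: induced_graph_def path_graph_def g h_def bij_betw_def inj_on_imp_bij_betw)
    show "parcs (path_graph ?n) = map_prod h h ` parcs (induced_graph V (path_edges p))"
      (is "?L = ?R")
    proof (intro equalityI subsetI)
      fix x assume "x \<in> ?L"
      then obtain i j where ij: "x = (i, j)" "i < ?n" "j < ?n" "j = Suc i \<or> i = Suc j"
        by (auto simp: path_graph_def)
      then have "(g i, g j) \<in> parcs (induced_graph V (path_edges p))"
        using adj by (auto simp: induced_graph_def g)
      moreover have "x = map_prod h h (g i, g j)" using ij by (simp add: hg)
      ultimately show "x \<in> ?R" by blast
    next
      fix x assume "x \<in> ?R"
      then obtain i j where "x = map_prod h h (g i, g j)" "i < ?n" "j < ?n"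
        "g i \<noteq> g j \<and> qf V (g i \<otimes> g j) = 1"
        by (auto simp: induced_graph_def g)
      then show "x \<in> ?L"
        using adj by (simp add: path_graph_def hg)
    qed
  qed
qed

lemma path_edges_subset:
  assumes "distinct p" "set p \<subseteq> X"
  shows "path_edges p \<subseteq> edges X"
  using assms by (auto simp: path_edges_def nth_eq_iff_index_eq intro!: edgesI)

text \<open>The frame is first shrunk until edges determine their ends; then a Hamiltonian path is
  grown and all other vectors are merged into it.\<close>

lemma transform_to_path:
  assumes W: "W \<subseteq> edges X" "crosses_cuts X W" and X: "finite X" "X \<noteq> {}"
  shows "\<exists>n W'. equivalent_sets V W W' \<and>
    digraph_iso (with_proj (induced_graph V W')) (with_proj (path_graph n))"
proof -
  obtain Z where Z: "Z \<subseteq> X" "Z \<noteq> {}" "edge_injective Z" "W \<subseteq> edges Z" "crosses_cuts Z W"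
    using exists_edge_injective_subframe[OF W X(2)] by blast
  interpret Z: root_frame V s Z
    by unfold_locales (use Z(1) frame_closed qf_frame in \<open>auto simp: subset_iff\<close>)
  have fin: "finite Z" using Z X finite_subset by blast
  \<comment> \<open>Nonemptiness of \<open>Z\<close> makes the truncated subtraction a true
    predecessor.\<close>
  then have "card Z - 1 < card Z" using Z by (simp add: card_gt_0_iff)
  then obtain p W1 where p: "(elementary_transformation V)\<^sup>*\<^sup>* W W1" "distinct p" "set p \<subseteq> Z"
    "length p = Suc (card Z - 1)" "path_edges p \<subseteq> W1"
    using Z.exists_long_path[OF Z(3) fin Z(2,4,5)] by blast
  have "card (set p) = card Z"
    using p fin Z by (simp add: distinct_card card_gt_0_iff)
  then have "set p = Z" using p fin by (simp add: card_subset_eq)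
  then have "(elementary_transformation V)\<^sup>*\<^sup>* W1 (path_edges p)"
    using Z.reduce_to_path p Z.elementary_transformations_edges[OF p(1) Z(4)] by blast
  then have "(elementary_transformation V)\<^sup>*\<^sup>* W (path_edges p)"
    using p(1) by (rule rtranclp_trans[rotated])
  then have "equivalent_sets V W (path_edges p)"
    unfolding equivalent_sets_def
    using Z.edges_anisotropic Z.path_edges_subset[OF p(2,3)] Z(4) by blast
  then show ?thesis
    using Z.induced_graph_path_edges[OF Z(3) p(2,3)] by blast
qed

end

section \<open>The frame of a path\<close>

context orthogonal_space
begin

primrec prefix_sum :: "(nat \<Rightarrow> 'v) \<Rightarrow> nat \<Rightarrow> 'v" where
  "prefix_sum w 0 = \<one>"
| "prefix_sum w (Suc k) = prefix_sum w k \<otimes> w k"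

lemma prefix_sum_closed:
  assumes "\<And>a. a < n \<Longrightarrow> w a \<in> carrier V" "k \<le> n"
  shows "prefix_sum w k \<in> carrier V"
  using assms(2) by (induction k) (auto simp: assms(1))

text \<open>For \<open>i < j\<close> the sum of the two prefix sums is the sum of the subpath
  \<open>w i, ..., w (j - 1)\<close>. Its \<open>Q\<close> counts vertices plus edges of that
  subpath mod 2, which is odd. A path of \<open>n\<close> vectors gives \<open>n + 1\<close> frame
  points.\<close>

lemma root_frame_prefix_sum:
  assumes w: "\<And>a. a < n \<Longrightarrow> w a \<in> carrier V" "\<And>a. a < n \<Longrightarrow> qf V (w a) = 1"
    and b: "\<And>a b. \<lbrakk>a < n; b < n\<rbrakk> \<Longrightarrow> bil V (w a) (w b) = of_bool (b = Suc a \<or> a = Suc b)"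
  shows "root_frame V (prefix_sum w) {..n}"
proof -
  note c = prefix_sum_closed[of n w, OF w(1)]
  \<comment> \<open>Beyond the subpath, only \<open>w j\<close> is adjacent to it, through its last
    vector \<open>w (j - 1)\<close>.\<close>
  have b': "bil V (prefix_sum w i \<otimes> prefix_sum w j) (w m) = of_bool (m = j)"
    if "i < j" "j \<le> m" "m < n" for i j m
    using that
  proof (induction j)
    case (Suc j)
    have *: "prefix_sum w i \<otimes> prefix_sum w (Suc j) = prefix_sum w i \<otimes> prefix_sum w j \<otimes> w j"
      using Suc.prems by (simp add: m_assoc c w)
    show ?case
    proof (cases "i = j")
      case True
      then show ?thesis
        unfolding * using Suc.prems by (simp add: exponent_two c w b)
    next
      case False
      then show ?thesis
        unfolding * using Suc by (simp add: bil_add_left c w b)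
    qed
  qed simp
  \<comment> \<open>Appending \<open>w j\<close> to a nonempty subpath adds
    \<open>Q (w j) = 1\<close> and one adjacency, which cancel.\<close>
  have lt: "qf V (prefix_sum w i \<otimes> prefix_sum w j) = 1" if "i < j" "j \<le> n" for i j
    using that
  proof (induction j)
    case (Suc j)
    have *: "prefix_sum w i \<otimes> prefix_sum w (Suc j) = prefix_sum w i \<otimes> prefix_sum w j \<otimes> w j"
      using Suc.prems by (simp add: m_assoc c w)
    show ?case
    proof (cases "i = j")
      case True
      then show ?thesis
        unfolding * using Suc.prems by (simp add: exponent_two c w)
    next
      case False
      then show ?thesis
        unfolding * using Suc b'[of i j j] by (simp add: qf_add[of "_ \<otimes> _"] c w)
    qed
  qed simp
  show ?thesis
  proof unfold_locales
    fix i j assume "i \<in> {..n}" "j \<in> {..n}"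
    then show "qf V (prefix_sum w i \<otimes> prefix_sum w j) = of_bool (i \<noteq> j)"
      using lt[of i j] lt[of j i]
      by (cases i j rule: linorder_cases) (auto simp: m_comm c exponent_two qf_zero)
  qed (simp add: c)
qed

text \<open>Listed along the path, \<open>W\<close> consists of the edges between consecutive prefix
  sums.\<close>

lemma path_graph_equivalent_imp_edges:
  assumes eq: "equivalent_sets V W0 W"
    and iso: "digraph_iso (with_proj (induced_graph V W)) (with_proj (path_graph n))"
  shows "\<exists>s. root_frame V s {..n} \<and> W0 \<subseteq> root_frame.edges V s {..n}"
proof -
  have W: "W0 \<subseteq> carrier V" "W \<subseteq> carrier V" "\<And>v. v \<in> W \<Longrightarrow> qf V v = 1"
    using eq by (auto simp: equivalent_sets_def anisotropic_def)
  obtain h where h: "bij_betw h W {..<n}"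
    and arcs: "parcs (path_graph n) = map_prod h h ` parcs (induced_graph V W)"
    using iso by (rule digraph_iso_with_projE) (auto simp: induced_graph_def path_graph_def)
  define w where "w = the_inv_into W h"
  have wb: "bij_betw w {..<n} W"
    using h unfolding w_def by (rule bij_betw_the_inv_into)
  then have wW: "w a \<in> W" if "a < n" for a using that by (auto simp: bij_betw_def)
  have wh: "w (h v) = v" if "v \<in> W" for v
    using h that by (simp add: w_def bij_betw_def the_inv_into_f_f)
  have hw: "h (w a) = a" if "a < n" for a
    using h that by (simp add: w_def bij_betw_def f_the_inv_into_f)
  have b: "bil V (w a) (w b) = of_bool (b = Suc a \<or> a = Suc b)" if "a < n" "b < n" for a b
  proof (cases "a = b")
    case True
    then show ?thesis using W(2) wW that by (auto simp: bil_self subset_iff)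
  next
    case False
    then have ne: "w a \<noteq> w b" using hw that by metis
    have "bil V (w a) (w b) = 1 \<longleftrightarrow> qf V (w a \<otimes> w b) = 1"
      using W wW that by (simp add: bil_def)
    also have "\<dots> \<longleftrightarrow> (w a, w b) \<in> parcs (induced_graph V W)"
      using wW that ne by (simp add: induced_graph_def)
    also have "\<dots> \<longleftrightarrow> (a, b) \<in> parcs (path_graph n)"
    proof
      assume "(w a, w b) \<in> parcs (induced_graph V W)"
      then have "map_prod h h (w a, w b) \<in> parcs (path_graph n)"
        unfolding arcs by (rule imageI)
      then show "(a, b) \<in> parcs (path_graph n)" using hw that by simp
    next
      assume "(a, b) \<in> parcs (path_graph n)"
      then obtain x y where "(x, y) \<in> parcs (induced_graph V W)" "a = h x" "b = h y"
        unfolding arcs by auto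
      then show "(w a, w b) \<in> parcs (induced_graph V W)"
        using wh by (auto simp: induced_graph_def)
    qed
    also have "\<dots> \<longleftrightarrow> b = Suc a \<or> a = Suc b"
      using that by (auto simp: path_graph_def)
    finally show ?thesis
      by (cases "bil V (w a) (w b)") auto
  qed
  interpret root_frame V "prefix_sum w" "{..n}"
    using wW W b by (intro root_frame_prefix_sum) auto
  have "v \<in> edges {..n}" if v: "v \<in> W" for v
  proof -
    obtain a where a: "a < n" "v = w a" using wb v by (auto simp: bij_betw_def)
    have "w a = edge a (Suc a)"
      unfolding edge_def using a W wW prefix_sum_closed[of n w a]
      by (simp add: add_cancel subset_iff)
    then show ?thesis using a by (auto intro!: edgesI)
  qed
  then have "W \<subseteq> edges {..n}" by blast
  \<comment> \<open>Equivalence allows either direction: transformations from \<open>W\<close> push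
    the inclusion forward, transformations from \<open>W0\<close> are undone.\<close>
  then have "W0 \<subseteq> edges {..n}"
    using eq W(1) elementary_transformations_edges elementary_transformations_edges_converse
    unfolding equivalent_sets_def by blast
  then show ?thesis using root_frame_axioms by blast
qed

end

section \<open>The minimal embedding of a line graph\<close>

context pair_graph
begin

lemma bil_universal_embedding_singletons:
  assumes r: "linear_order_on (pverts G) r" and x: "x \<in> pverts G" and y: "y \<in> pverts G"
  shows "bil (universal_embedding G r) {x} {y} = of_bool ((x, y) \<in> parcs G)"
proof -
  let ?U = "universal_embedding G r"
  interpret U: orthogonal_space ?U by (rule orthogonal_space_universal_embedding)
  show ?thesis
  proof (cases "x = y")
    case True
    then show ?thesis
      using x pair_no_loops[of "(x, x)"] U.bil_self[of "{x}"]
      by (auto simp: universal_embedding_def)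
  next
    case False
    let ?P = "\<lambda>u. {(a, b) \<in> u \<times> u. a = b \<or> ((a, b) \<in> r \<and> a \<noteq> b \<and> (a, b) \<in> parcs G)}"
    have "total_on (pverts G) r" "antisym r"
      using r by (auto simp: linear_order_on_def partial_order_on_def)
    \<comment> \<open>Exactly one orientation of the pair lies in \<open>r\<close>, so an edge
      contributes once to \<open>Q {x, y}\<close>, whichever order is chosen.\<close>
    then have xy: "(x, y) \<in> r \<longleftrightarrow> (y, x) \<notin> r"
      using x y False by (auto simp: total_on_def dest: antisymD)
    have sym: "(y, x) \<in> parcs G \<longleftrightarrow> (x, y) \<in> parcs G"
      using pair_sym_arcs by (auto simp: symmetric_def elim: symE)
    have "?P {z} = {(z, z)}" for z by auto
    then have q1: "qf ?U {z} = 1" for z by (simp add: universal_embedding_def)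
    have "?P {x, y} = (if (x, y) \<in> parcs G then
        {(x, x), (y, y), if (x, y) \<in> r then (x, y) else (y, x)} else {(x, x), (y, y)})"
      using False xy sym by auto
    then have "card (?P {x, y}) = 2 + of_bool ((x, y) \<in> parcs G)"
      using False by auto
    moreover have "qf ?U {x, y} = of_nat (card (?P {x, y}))"
      by (simp only: universal_embedding_def quad_space.select_convs)
    ultimately have "qf ?U {x, y} = of_bool ((x, y) \<in> parcs G)" by simp
    moreover have "{x} \<otimes>\<^bsub>?U\<^esub> {y} = {x, y}"
      using False by (auto simp: universal_embedding_def)
    ultimately show ?thesis by (simp add: bil_def q1)
  qed
qed

text \<open>Arcs come in opposite pairs, so connectedness yields a directed walk from
  \<open>x\<close> to \<open>y\<close>; without an arc leaving \<open>A\<close> it would stay in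
  \<open>A\<close>.\<close>

lemma connected_crossing_arc:
  assumes c: "Digraph_Component.connected (with_proj G)"
    and "x \<in> A" "x \<in> pverts G" "y \<in> pverts G" "y \<notin> A"
  shows "\<exists>a\<in>A. \<exists>b\<in>pverts G - A. (a, b) \<in> parcs G"
proof (rule ccontr)
  assume no: "\<not> ?thesis"
  have "strongly_connected (with_proj G)"
    using symmetric_connected_imp_strongly_connected[OF pair_sym_arcs c] .
  then have "x \<rightarrow>\<^sup>*\<^bsub>with_proj G\<^esub> y"
    using assms by (auto simp: strongly_connected_def)
  then have "y \<in> A"
  proof (induction rule: reachable_induct)
    case base
    then show ?case using assms by simp
  next
    case (step a b)
    then show ?case using no in_arcsD2 by auto
  qed
  then show False using assms by simp
qed

text \<open>Relabelling the edges of the multi-graph by the vertices of \<open>G\<close> absorbs the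
  isomorphism and leaves only the map to end sets.\<close>

lemma is_line_graph_iff_ends:
  "is_line_graph G \<longleftrightarrow> (\<exists>eps :: 'a \<Rightarrow> nat set. (\<forall>x\<in>pverts G. card (eps x) = 2) \<and>
     (\<forall>x\<in>pverts G. \<forall>y\<in>pverts G. (x, y) \<in> parcs G \<longleftrightarrow> card (eps x \<inter> eps y) = 1))"
  (is "?L \<longleftrightarrow> (\<exists>eps. ?R eps)")
proof
  assume ?L
  then obtain M :: "(nat, 'a) multigraph" where M: "multigraph M"
    "digraph_iso (with_proj (line_graph M)) (with_proj G)"
    unfolding is_line_graph_def by blast
  obtain h where h: "bij_betw h (medges M) (pverts G)"
    and arcs: "parcs G = map_prod h h ` parcs (line_graph M)"
    using M(2) by (rule digraph_iso_with_projE) (auto simp: line_graph_def)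
  define k where "k = the_inv_into (medges M) h"
  have k: "k x \<in> medges M" "h (k x) = x" if "x \<in> pverts G" for x
    using h that unfolding k_def
    by (auto simp: bij_betw_def f_the_inv_into_f intro!: the_inv_into_into)
  have kh: "k (h e) = e" if "e \<in> medges M" for e
    using h that by (simp add: k_def bij_betw_def the_inv_into_f_f)
  have "(x, y) \<in> parcs G \<longleftrightarrow> card (ends M (k x) \<inter> ends M (k y)) = 1"
    if xy: "x \<in> pverts G" "y \<in> pverts G" for x y
  proof
    assume "(x, y) \<in> parcs G"
    then obtain e e' where "(e, e') \<in> parcs (line_graph M)" "x = h e" "y = h e'"
      unfolding arcs by auto
    then show "card (ends M (k x) \<inter> ends M (k y)) = 1"
      by (auto simp: line_graph_def kh)
  next
    assume "card (ends M (k x) \<inter> ends M (k y)) = 1"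
    then have "(k x, k y) \<in> parcs (line_graph M)"
      using k(1) xy by (auto simp: line_graph_def)
    then have "map_prod h h (k x, k y) \<in> parcs G" unfolding arcs by (rule imageI)
    then show "(x, y) \<in> parcs G" using k(2) xy by simp
  qed
  moreover have "card (ends M (k x)) = 2" if "x \<in> pverts G" for x
    using M(1) k(1)[OF that] by (simp add: multigraph_def)
  ultimately show "\<exists>eps. ?R eps" by (intro exI[of _ "\<lambda>x. ends M (k x)"]) blast
next
  assume "\<exists>eps. ?R eps"
  then obtain eps :: "'a \<Rightarrow> nat set" where eps: "?R eps" by blast
  \<comment> \<open>Isolated vertices do not affect the line graph, so all of \<open>nat\<close> can
    serve as vertex set.\<close>
  let ?M = "\<lparr> mverts = UNIV, medges = pverts G, ends = eps \<rparr>"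
  have wf: "parcs G \<subseteq> pverts G \<times> pverts G"
    by (auto dest: in_arcsD1 in_arcsD2)
  then have "parcs G = {(x, y). x \<in> pverts G \<and> y \<in> pverts G \<and> card (eps x \<inter> eps y) = 1}"
    using eps by blast
  then have "line_graph ?M = G"
    by (simp add: line_graph_def)
  moreover have "digraph_iso (with_proj G) (with_proj G)"
    using wf by (intro digraph_iso_with_projI[where h = id]) (simp_all add: prod.map_id0)
  ultimately show ?L
    unfolding is_line_graph_def using eps
    by (intro exI[of _ ?M]) (simp add: multigraph_def)
qed

end

text \<open>Toggling two points changes the size by -2, 0 or 2, hence half of it by an odd amount
  exactly when both or neither of them lay in \<open>A\<close>. This is the inductive step for
  \<open>Q\<close>.\<close>

lemma half_card_sym_diff_pair:
  assumes A: "finite A" "even (card A)" and ij: "i \<noteq> j"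
  shows "even (card (sym_diff A {i, j})) \<and> (of_nat (card (sym_diff A {i, j}) div 2) :: bit)
    = of_nat (card A div 2) + 1 + of_bool (i \<in> A) + of_bool (j \<in> A)"
proof -
  consider "i \<in> A" "j \<in> A" | "i \<in> A" "j \<notin> A" | "i \<notin> A" "j \<in> A" | "i \<notin> A" "j \<notin> A" by blast
  then show ?thesis
  proof cases
    case 1
    have "sym_diff A {i, j} = A - {i, j}" using 1 by auto
    moreover have "card A = card (A - {i, j}) + 2"
      using card_Diff_subset[of "{i, j}" A] card_mono[of A "{i, j}"] A 1 ij by simp
    ultimately show ?thesis using 1 A by (simp add: ac_simps)
  next
    case 2
    have "sym_diff A {i, j} = insert j (A - {i})" using 2 by auto
    moreover have "card (insert j (A - {i})) = card A"
      using 2 A ij card_Suc_Diff1[of A i] by simp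
    ultimately show ?thesis using 2 A by (simp add: ac_simps)
  next
    case 3
    have "sym_diff A {i, j} = insert i (A - {j})" using 3 by auto
    moreover have "card (insert i (A - {j})) = card A"
      using 3 A ij card_Suc_Diff1[of A j] by simp
    ultimately show ?thesis using 3 A by (simp add: ac_simps)
  next
    case 4
    have "sym_diff A {i, j} = insert i (insert j A)" using 4 by auto
    then have "card (sym_diff A {i, j}) = card A + 2" using 4 A ij by simp
    then show ?thesis using 4 A by (simp add: ac_simps)
  qed
qed

section \<open>The boundary map\<close>

locale line_graph_representation = pair_graph G for G :: "'a pair_pre_digraph" +
  fixes r :: "'a rel" and eps :: "'a \<Rightarrow> nat set"
  assumes conn: "Digraph_Component.connected (with_proj G)"
    and order: "linear_order_on (pverts G) r"
    and card_eps: "x \<in> pverts G \<Longrightarrow> card (eps x) = 2"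
    and adj_eps: "\<lbrakk>x \<in> pverts G; y \<in> pverts G\<rbrakk> \<Longrightarrow>
      (x, y) \<in> parcs G \<longleftrightarrow> card (eps x \<inter> eps y) = 1"
begin

abbreviation U :: "'a set quad_space" where
  "U \<equiv> universal_embedding G r"

sublocale U: orthogonal_space U
  by (rule orthogonal_space_universal_embedding)

text \<open>The points of odd degree in the edge set \<open>u\<close>: the boundary of a 1-chain mod
  2. The sum in \<open>bit\<close> makes additivity immediate.\<close>

definition boundary :: "'a set \<Rightarrow> nat set" where
  "boundary u = {i. (\<Sum>x\<in>u. of_bool (i \<in> eps x)) = (1 :: bit)}"

lemma of_bool_boundary: "of_bool (i \<in> boundary u) = (\<Sum>x\<in>u. of_bool (i \<in> eps x) :: bit)"
  by (auto simp: boundary_def simp del: sum_of_bool_eq)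

lemma carrier_U: "u \<in> carrier U \<longleftrightarrow> u \<subseteq> pverts G"
  using pair_finite_verts by (auto simp: universal_embedding_def intro: finite_subset)

lemma mult_U: "u \<otimes>\<^bsub>U\<^esub> w = sym_diff u w"
  by (simp add: universal_embedding_def)

lemma one_U: "\<one>\<^bsub>U\<^esub> = {}"
  by (simp add: universal_embedding_def)

lemma finite_vertices: "u \<subseteq> pverts G \<Longrightarrow> finite u"
  using pair_finite_verts finite_subset by blast

lemma boundary_empty [simp]: "boundary {} = {}"
  by (simp add: boundary_def)

lemma boundary_singleton [simp]: "boundary {x} = eps x"
  by (simp add: boundary_def del: sum_of_bool_eq)

lemma boundary_sym_diff:
  assumes "u \<subseteq> pverts G" "w \<subseteq> pverts G"
  shows "boundary (sym_diff u w) = sym_diff (boundary u) (boundary w)"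
proof -
  have "of_bool (i \<in> boundary (sym_diff u w))
      = (of_bool (i \<in> boundary u) + of_bool (i \<in> boundary w) :: bit)" for i
    using assms unfolding of_bool_boundary
    by (simp add: sum_symdiff_bit finite_vertices del: sum_of_bool_eq)
  then have "i \<in> boundary (sym_diff u w) \<longleftrightarrow> (i \<in> boundary u) \<noteq> (i \<in> boundary w)" for i
    by (metis add.left_neutral add.right_neutral bit_add_self(1) of_bool_eq_iff of_bool_eq(1,2))
  then show ?thesis by auto
qed

lemma finite_eps: "x \<in> pverts G \<Longrightarrow> finite (eps x)"
  using card_eps by (intro card_ge_0_finite) simp

lemma finite_boundary:
  assumes "u \<subseteq> pverts G"
  shows "finite (boundary u)"
proof (rule finite_subset)
  show "boundary u \<subseteq> (\<Union>x\<in>u. eps x)"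
  proof
    fix i assume "i \<in> boundary u"
    then have "(\<Sum>x\<in>u. of_bool (i \<in> eps x) :: bit) \<noteq> 0"
      by (simp add: boundary_def del: sum_of_bool_eq)
    then obtain x where "x \<in> u" "i \<in> eps x"
      by (metis (mono_tags, lifting) of_bool_eq(1) sum.neutral)
    then show "i \<in> (\<Union>x\<in>u. eps x)" by blast
  qed
  show "finite (\<Union>x\<in>u. eps x)"
    using assms finite_eps by (intro finite_UN_I finite_vertices) auto
qed

lemma eps_pairE:
  assumes "x \<in> pverts G"
  obtains i j where "eps x = {i, j}" "i \<noteq> j"
  using card_eps[OF assms] by (auto simp: card_2_iff)

lemma insert_as_mult: "x \<notin> u \<Longrightarrow> insert x u = {x} \<otimes>\<^bsub>U\<^esub> u"
  by (auto simp: mult_U)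

text \<open>Both sides are additive in \<open>u\<close>. For one edge \<open>x\<close>, having
  exactly one end in \<open>{i, j}\<close> is the sum mod 2 of the two incidences.\<close>

lemma bil_boundary:
  assumes u: "u \<subseteq> pverts G" and y: "y \<in> pverts G" and ij: "eps y = {i, j}" "i \<noteq> j"
  shows "bil U u {y} = of_bool (i \<in> boundary u) + of_bool (j \<in> boundary u)"
  using finite_vertices[OF u] u
proof (induction u rule: finite_induct)
  case empty
  then show ?case using U.bil_zero_left[of "{y}"] y by (simp add: carrier_U one_U)
next
  case (insert x u)
  then have "x \<in> pverts G" "u \<subseteq> pverts G" by auto
  then have "bil U (insert x u) {y} = bil U {x} {y} + bil U u {y}"
    using y by (simp add: insert_as_mult[OF insert.hyps(2)] U.bil_add_left carrier_U)
  moreover have "bil U {x} {y} = of_bool (card (eps x \<inter> {i, j}) = 1)"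
    using insert.prems y by (simp add: bil_universal_embedding_singletons[OF order] adj_eps ij)
  moreover have "(of_bool (card (eps x \<inter> {i, j}) = 1) :: bit)
      = of_bool (i \<in> eps x) + of_bool (j \<in> eps x)"
    using ij(2) by (auto simp: Int_insert_right)
  ultimately show ?case
    using insert unfolding of_bool_boundary by (simp add: ac_simps del: sum_of_bool_eq)
qed

text \<open>Adding \<open>x\<close> changes \<open>Q\<close> and half the boundary size by the same
  amount. Evenness belongs to the same induction, since halving relies on it.\<close>

lemma qf_boundary:
  assumes u: "u \<subseteq> pverts G"
  shows "even (card (boundary u)) \<and> qf U u = of_nat (card (boundary u) div 2)"
  using finite_vertices[OF u] u
proof (induction u rule: finite_induct)
  case empty
  then show ?case by (simp add: universal_embedding_def)
next
  case (insert x u)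
  then have x: "x \<in> pverts G" "u \<subseteq> pverts G" by auto
  obtain i j where ij: "eps x = {i, j}" "i \<noteq> j" using eps_pairE[OF x(1)] .
  have "insert x u = sym_diff u {x}" using insert by auto
  then have b: "boundary (insert x u) = sym_diff (boundary u) {i, j}"
    using boundary_sym_diff[of u "{x}"] x ij by simp
  have "{(a, b) \<in> {x} \<times> {x}. a = b \<or> ((a, b) \<in> r \<and> a \<noteq> b \<and> (a, b) \<in> parcs G)} = {(x, x)}"
    by auto
  then have "qf U {x} = 1" by (simp add: universal_embedding_def)
  moreover have "bil U {x} u = of_bool (i \<in> boundary u) + of_bool (j \<in> boundary u)"
    using bil_boundary[OF x(2,1) ij] U.bil_commute[of "{x}" u] x by (simp add: carrier_U)
  ultimately have q: "qf U (insert x u)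
      = of_nat (card (boundary u) div 2) + 1 + of_bool (i \<in> boundary u) + of_bool (j \<in> boundary u)"
    using insert x by (simp add: insert_as_mult[OF insert.hyps(2)] U.qf_add ac_simps)
  have "even (card (boundary u))" using insert.IH x(2) by blast
  note half = half_card_sym_diff_pair[OF finite_boundary[OF x(2)] this ij(2)]
  show ?case
    unfolding b q half[THEN conjunct2] using half by (intro conjI refl) blast
qed

lemma boundary_empty_imp_radical:
  assumes u: "u \<subseteq> pverts G" and b: "boundary u = {}"
  shows "u \<in> isotropic_radical U"
proof -
  have "bil U u w = 0" if "w \<subseteq> pverts G" for w
    using finite_vertices[OF that] that
  proof (induction w rule: finite_induct)
    case empty
    then show ?case
      using U.bil_commute[of "{}" u] U.bil_zero_left[of u] u by (simp add: carrier_U one_U)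
  next
    case (insert y w)
    then obtain i j where "eps y = {i, j}" "i \<noteq> j" using eps_pairE by auto
    then have "bil U u {y} = 0" using bil_boundary[OF u] insert.prems b by simp
    moreover have "y \<in> pverts G" "w \<subseteq> pverts G" using insert.prems by auto
    ultimately show ?case
      using insert.IH u by (simp add: insert_as_mult[OF insert.hyps(2)] U.bil_add_right carrier_U)
  qed
  moreover have "qf U u = 0" using qf_boundary[OF u] b by simp
  ultimately show ?thesis using u by (simp add: isotropic_radical_def carrier_U)
qed

text \<open>The sum of the two sets has empty boundary and so lies in the radical.\<close>

lemma coset_eq_if_boundary_eq:
  assumes u: "u \<subseteq> pverts G" and w: "w \<subseteq> pverts G" and b: "boundary u = boundary w"
  shows "isotropic_radical U #>\<^bsub>U\<^esub> u = isotropic_radical U #>\<^bsub>U\<^esub> w"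
proof -
  let ?R = "isotropic_radical U"
  have c: "u \<in> carrier U" "w \<in> carrier U" using u w by (auto simp: carrier_U)
  have "sym_diff u w \<in> ?R"
    using u w b by (intro boundary_empty_imp_radical) (auto simp: boundary_sym_diff)
  then have "?R #>\<^bsub>U\<^esub> (u \<otimes>\<^bsub>U\<^esub> w) = ?R"
    using c by (intro U.coset_join2 U.subgroup_isotropic_radical U.m_closed) (auto simp: mult_U)
  then have "?R #>\<^bsub>U\<^esub> w = ?R #>\<^bsub>U\<^esub> (u \<otimes>\<^bsub>U\<^esub> w \<otimes>\<^bsub>U\<^esub> w)"
    using c U.coset_mult_assoc[of ?R "u \<otimes>\<^bsub>U\<^esub> w" w]
      subgroup.subset[OF U.subgroup_isotropic_radical] by simp
  then show ?thesis using c by (simp add: U.add_right_cancel)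
qed

text \<open>Only points that lie on an edge are kept, so that connectedness of \<open>G\<close>
  carries over to them.\<close>

definition end_points :: "nat set" where
  "end_points = (\<Union>x\<in>pverts G. eps x)"

text \<open>If no edge crossed, each end set would lie inside \<open>Y\<close> or be disjoint from
  it. Both kinds occur, and an arc of \<open>G\<close> between them would need a common end.\<close>

lemma eps_crosses_cuts:
  assumes "Y \<subset> end_points" "Y \<noteq> {}"
  shows "\<exists>x\<in>pverts G. \<exists>i\<in>Y. \<exists>j\<in>end_points - Y. eps x = {i, j}"
proof (rule ccontr)
  assume no: "\<not> ?thesis"
  have sub: "eps x \<subseteq> Y" if x: "x \<in> pverts G" "eps x \<inter> Y \<noteq> {}" for x
  proof -
    obtain i j where ij: "eps x = {i, j}" "i \<noteq> j" using eps_pairE[OF x(1)] .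
    then obtain a b where ab: "eps x = {a, b}" "a \<in> Y"
      using x(2) by (auto simp: insert_commute)
    have "b \<in> end_points" using x(1) ab by (auto simp: end_points_def)
    then show ?thesis using no x(1) ab by auto
  qed
  define A where "A = {x \<in> pverts G. eps x \<subseteq> Y}"
  obtain i where "i \<in> Y" using assms by blast
  then obtain x where x: "x \<in> pverts G" "i \<in> eps x" using assms by (auto simp: end_points_def)
  then have "x \<in> A" using sub[of x] \<open>i \<in> Y\<close> by (auto simp: A_def)
  obtain j where "j \<in> end_points" "j \<notin> Y" using assms by blast
  then obtain y where y: "y \<in> pverts G" "y \<notin> A" by (auto simp: end_points_def A_def)
  obtain a b where ab: "a \<in> A" "b \<in> pverts G - A" "(a, b) \<in> parcs G"
    using connected_crossing_arc[OF conn \<open>x \<in> A\<close> x(1) y] by blast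
  then have "eps a \<subseteq> Y" "eps b \<inter> Y = {}" using sub[of b] by (auto simp: A_def)
  then have "eps a \<inter> eps b = {}" by blast
  then show False using adj_eps[of a b] ab by (auto simp: A_def)
qed

text \<open>The edges of a path from \<open>z\<close> to \<open>i\<close> would do; the set of
  points reached in this way cannot have an edge leaving it. Writing \<open>sym_diff {z} {i}\<close>
  covers \<open>i = z\<close> by the empty boundary.\<close>

lemma exists_boundary:
  assumes z: "z \<in> end_points" and i: "i \<in> end_points"
  shows "\<exists>u. u \<subseteq> pverts G \<and> boundary u = sym_diff {z} {i}"
proof -
  define Y where "Y = {i \<in> end_points. \<exists>u. u \<subseteq> pverts G \<and> boundary u = sym_diff {z} {i}}"
  have "\<exists>u. u \<subseteq> pverts G \<and> boundary u = sym_diff {z} {z}"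
    by (rule exI[of _ "{}"]) simp
  then have "z \<in> Y" using z by (simp add: Y_def)
  have "Y = end_points"
  proof (rule ccontr)
    assume "Y \<noteq> end_points"
    moreover have "Y \<subseteq> end_points" unfolding Y_def by blast
    ultimately have Y: "Y \<subset> end_points" "Y \<noteq> {}" using \<open>z \<in> Y\<close> by auto
    obtain x i j where x: "x \<in> pverts G" "i \<in> Y" "j \<in> end_points - Y" "eps x = {i, j}"
      using eps_crosses_cuts[OF Y] by blast
    then obtain u where u: "u \<subseteq> pverts G" "boundary u = sym_diff {z} {i}"
      unfolding Y_def by blast
    have "i \<noteq> j" using x by auto
    then have "sym_diff (sym_diff {z} {i}) {i, j} = sym_diff {z} {j}" by blast
    then have "boundary (sym_diff u {x}) = sym_diff {z} {j}"
      using boundary_sym_diff[of u "{x}"] u x by simp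
    moreover have "sym_diff u {x} \<subseteq> pverts G" using u x by auto
    ultimately have "j \<in> Y" using x unfolding Y_def by blast
    then show False using x by simp
  qed
  then show ?thesis using i unfolding Y_def by blast
qed

lemma minimal_image_equivalent_to_path:
  "\<exists>n W. equivalent_sets (minimal_embedding G r) (minimal_image G r) W \<and>
    digraph_iso (with_proj (induced_graph (minimal_embedding G r) W)) (with_proj (path_graph n))"
proof -
  let ?M = "minimal_embedding G r" and ?R = "isotropic_radical U"
  define cl where "cl u = ?R #>\<^bsub>U\<^esub> u" for u
  have "pverts G \<noteq> {}" using conn by (auto simp: connected_conv)
  then have "end_points \<noteq> {}" using card_eps by (fastforce simp: end_points_def)
  then obtain z where z: "z \<in> end_points" by blast
  obtain u where u: "\<And>i. i \<in> end_points \<Longrightarrow> u i \<subseteq> pverts G"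
    "\<And>i. i \<in> end_points \<Longrightarrow> boundary (u i) = sym_diff {z} {i}"
    using exists_boundary[OF z] by metis
  \<comment> \<open>The base point \<open>z\<close> occurs twice and cancels.\<close>
  have b2: "boundary (u i \<otimes>\<^bsub>U\<^esub> u j) = sym_diff {i} {j}" "u i \<otimes>\<^bsub>U\<^esub> u j \<subseteq> pverts G"
    if "i \<in> end_points" "j \<in> end_points" for i j
    using that u[of i] u[of j] boundary_sym_diff[of "u i" "u j"] by (auto simp: mult_U)
  have clM: "cl (u i) \<otimes>\<^bsub>?M\<^esub> cl (u j) = cl (u i \<otimes>\<^bsub>U\<^esub> u j)"
    if "i \<in> end_points" "j \<in> end_points" for i j
    using that u U.mult_radical_quotient[of "u i" "u j"]
    by (simp add: cl_def minimal_embedding_def carrier_U)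
  interpret M: orthogonal_space ?M by (rule orthogonal_space_minimal_embedding)
  interpret M: root_frame ?M "\<lambda>i. cl (u i)" end_points
  proof unfold_locales
    fix i assume "i \<in> end_points"
    then show "cl (u i) \<in> carrier ?M"
      using u by (auto simp: cl_def minimal_embedding_def U.carrier_radical_quotient carrier_U)
  next
    fix i j assume ij: "i \<in> end_points" "j \<in> end_points"
    have "qf ?M (cl (u i) \<otimes>\<^bsub>?M\<^esub> cl (u j)) = qf U (u i \<otimes>\<^bsub>U\<^esub> u j)"
      unfolding clM[OF ij] using b2(2)[OF ij]
      by (simp add: cl_def minimal_embedding_def U.qf_radical_quotient carrier_U)
    also have "\<dots> = of_nat (card (sym_diff {i} {j}) div 2)"
      using qf_boundary b2[OF ij] by auto
    also have "\<dots> = of_bool (i \<noteq> j)"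
      by (cases "i = j") (auto simp: Un_commute insert_Diff_if)
    finally show "qf ?M (cl (u i) \<otimes>\<^bsub>?M\<^esub> cl (u j)) = of_bool (i \<noteq> j)" .
  qed
  \<comment> \<open>\<open>{x}\<close> and \<open>u i + u j\<close> have the same boundary
    \<open>{i, j}\<close>, hence the same class.\<close>
  have edge: "cl {x} = M.edge i j" if "x \<in> pverts G" "eps x = {i, j}" "i \<noteq> j" for x i j
  proof -
    have ij: "i \<in> end_points" "j \<in> end_points" using that by (auto simp: end_points_def)
    have "boundary {x} = boundary (u i \<otimes>\<^bsub>U\<^esub> u j)"
      unfolding b2(1)[OF ij] using that by auto
    then show ?thesis
      unfolding M.edge_def clM[OF ij] unfolding cl_def
      using that b2(2)[OF ij] by (intro coset_eq_if_boundary_eq) auto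
  qed
  have img: "minimal_image G r = (\<lambda>x. cl {x}) ` pverts G"
    by (simp add: minimal_image_def cl_def Let_def)
  have "minimal_image G r \<subseteq> M.edges end_points"
  proof
    fix v assume "v \<in> minimal_image G r"
    then obtain x where x: "x \<in> pverts G" "v = cl {x}" unfolding img by blast
    obtain i j where ij: "eps x = {i, j}" "i \<noteq> j" using eps_pairE[OF x(1)] .
    then have "i \<in> end_points" "j \<in> end_points" using x(1) by (auto simp: end_points_def)
    then show "v \<in> M.edges end_points"
      unfolding x(2) edge[OF x(1) ij] using ij(2) by (rule M.edgesI)
  qed
  moreover have "M.crosses_cuts end_points (minimal_image G r)"
    unfolding M.crosses_cuts_def
  proof (intro allI impI)
    fix Y assume Y: "Y \<subset> end_points" "Y \<noteq> {}"
    obtain x i j where x: "x \<in> pverts G" "i \<in> Y" "j \<in> end_points - Y" "eps x = {i, j}"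
      using eps_crosses_cuts[OF Y] by blast
    then have "i \<noteq> j" by auto
    have "M.edge i j \<in> minimal_image G r"
      unfolding img edge[OF x(1,4) \<open>i \<noteq> j\<close>, symmetric] using x(1) by blast
    then show "\<exists>i\<in>Y. \<exists>j\<in>end_points - Y. M.edge i j \<in> minimal_image G r" using x by blast
  qed
  moreover have "finite end_points"
    using finite_eps pair_finite_verts unfolding end_points_def by blast
  moreover have "end_points \<noteq> {}" using z by blast
  ultimately show ?thesis by (rule M.transform_to_path)
qed

end

section \<open>Recovering a multi-graph from the frame\<close>

lemma (in pair_graph) equivalent_to_path_imp_line_graph:
  assumes order: "linear_order_on (pverts G) r"
    and eq: "equivalent_sets (minimal_embedding G r) (minimal_image G r) W"
    and iso: "digraph_iso (with_proj (induced_graph (minimal_embedding G r) W))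
      (with_proj (path_graph n))"
  shows "is_line_graph G"
proof -
  let ?M = "minimal_embedding G r" and ?U = "universal_embedding G r"
  define cl where "cl x = isotropic_radical ?U #>\<^bsub>?U\<^esub> {x}" for x
  interpret U: orthogonal_space ?U by (rule orthogonal_space_universal_embedding)
  interpret M: orthogonal_space ?M by (rule orthogonal_space_minimal_embedding)
  obtain s where s: "root_frame ?M s {..n}"
    "minimal_image G r \<subseteq> root_frame.edges ?M s {..n}"
    using M.path_graph_equivalent_imp_edges[OF eq iso] by blast
  interpret M: root_frame ?M s "{..n}" by (rule s(1))
  have "\<exists>i j. i \<le> n \<and> j \<le> n \<and> i \<noteq> j \<and> cl x = M.edge i j" if "x \<in> pverts G" for x
  proof -
    have "cl x \<in> minimal_image G r"
      using that by (auto simp: minimal_image_def cl_def Let_def)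
    then show ?thesis using s(2) unfolding M.edges_def by blast
  qed
  \<comment> \<open>Ends are chosen for each vertex of \<open>G\<close> separately. Vertices with
    the same image have \<open>f = 0\<close>, so their chosen end pairs share two points or none, in
    accordance with non-adjacency.\<close>
  then obtain a b where ab: "\<And>x. x \<in> pverts G \<Longrightarrow>
      a x \<le> n \<and> b x \<le> n \<and> a x \<noteq> b x \<and> cl x = M.edge (a x) (b x)"
    by metis
  have "(x, y) \<in> parcs G \<longleftrightarrow> card ({a x, b x} \<inter> {a y, b y}) = 1"
    if "x \<in> pverts G" "y \<in> pverts G" for x y
  proof -
    \<comment> \<open>The quotient preserves \<open>f\<close>, so adjacency in \<open>G\<close> can
      be read off from the images.\<close>
    have "bil ?M (cl x) (cl y) = bil ?U {x} {y}"
      using that unfolding cl_def minimal_embedding_def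
      by (intro U.bil_radical_quotient) (auto simp: universal_embedding_def)
    then have "(x, y) \<in> parcs G \<longleftrightarrow> bil ?M (cl x) (cl y) = 1"
      using bil_universal_embedding_singletons[OF order that] by simp
    then show ?thesis
      using ab[OF that(1)] ab[OF that(2)] by (simp add: M.bil_edge_eq_1_iff)
  qed
  moreover have "card {a x, b x} = 2" if "x \<in> pverts G" for x
    using ab[OF that] by simp
  ultimately show ?thesis
    unfolding is_line_graph_iff_ends by (intro exI[of _ "\<lambda>x. {a x, b x}"] conjI ballI)
qed

theorem theorem3p4:
  fixes G :: "'a pair_pre_digraph" and r :: "'a rel"
  assumes "pair_graph G"
    and "Digraph_Component.connected (with_proj G)"
    and "linear_order_on (pverts G) r"
  shows "is_line_graph G \<longleftrightarrow>
    (\<exists>n W. equivalent_sets (minimal_embedding G r) (minimal_image G r) W \<and>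
      digraph_iso (with_proj (induced_graph (minimal_embedding G r) W)) (with_proj (path_graph n)))"
proof
  interpret pair_graph G by fact
  assume "is_line_graph G"
  then obtain eps :: "'a \<Rightarrow> nat set" where "line_graph_representation G r eps"
    using assms unfolding is_line_graph_iff_ends
    by (auto simp: line_graph_representation_def line_graph_representation_axioms_def)
  then show "\<exists>n W. equivalent_sets (minimal_embedding G r) (minimal_image G r) W \<and>
      digraph_iso (with_proj (induced_graph (minimal_embedding G r) W)) (with_proj (path_graph n))"
    by (rule line_graph_representation.minimal_image_equivalent_to_path)
next
  assume "\<exists>n W. equivalent_sets (minimal_embedding G r) (minimal_image G r) W \<and>
      digraph_iso (with_proj (induced_graph (minimal_embedding G r) W)) (with_proj (path_graph n))"
  then show "is_line_graph G"
    by (elim exE conjE) (rule pair_graph.equivalent_to_path_imp_line_graph[OF assms(1,3)])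
qed

end
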